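(* Let $\ell_2,\ell_3,\ell_4\ge 1$ be integers and $k=1+\ell_2+\ell_3+\ell_4$. Let $G$ be a finite simple $2$-connected graph with average degree $\bar d>k-1$ (equivalently, $e(G)>|V(G)|(k-1)/2$). Then $G$ contains the $k$-spider $S_{1,\ell_2,\ell_3,\ell_4}$.
   Context: The spider $S_{1,\ell_2,\ell_3,\ell_4}$ is the tree consisting of a root vertex together with four paths (legs) starting at the root, otherwise pairwise vertex-disjoint, of lengths (numbers of edges) $1,\ell_2,\ell_3,\ell_4$; it has $k=1+\ell_2+\ell_3+\ell_4$ edges. "Contains" means has a (not necessarily induced) subgraph isomorphic to it. *)

theory Defs
  imports Complex_Main "Graph_Theory.Graph_Theory"
begin

text \<open>
  A finite simple graph is a symmetric loop-free digraph without parallel arcs (locale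
  \<^locale>\<open>graph\<close>), so every undirected edge is a pair of opposite arcs and the degree of a
  vertex is its out-degree.
\<close>

definition average_degree :: "('a, 'b) pre_digraph \<Rightarrow> real" where
  "average_degree G = (\<Sum>v\<in>verts G. real (out_degree G v)) / real (card (verts G))"

text \<open>
  The usual convention that a 2-connected graph has more than two vertices, so that the
  one-edge graph is excluded. The name \<open>connected\<close> is qualified because the topological notion
  is also in scope.
\<close>

definition two_connected :: "('a, 'b) pre_digraph \<Rightarrow> bool" where
  "two_connected G \<longleftrightarrow> 2 < card (verts G) \<and> Digraph_Component.connected G \<and>
     (\<forall>v \<in> verts G. Digraph_Component.connected (pre_digraph.del_vert G v))"

definition contains_copy :: "('a, 'b) pre_digraph \<Rightarrow> ('c, 'd) pre_digraph \<Rightarrow> bool" where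
  "contains_copy G S \<longleftrightarrow> (\<exists>H. subgraph H G \<and> digraph_iso S H)"

text \<open>
  The spider whose \<open>i\<close>-th leg (counted from 0) has length \<open>ls ! i\<close>; \<open>Leg i j\<close> is the vertex
  of leg \<open>i\<close> at distance \<open>j + 1\<close> from the root.
\<close>

datatype spider_vertex = Root | Leg nat nat

fun toward_root :: "spider_vertex \<Rightarrow> spider_vertex" where
  "toward_root Root = Root"
| "toward_root (Leg i 0) = Root"
| "toward_root (Leg i (Suc j)) = Leg i j"

definition leg_verts :: "nat list \<Rightarrow> spider_vertex set" where
  "leg_verts ls = {Leg i j | i j. i < length ls \<and> j < ls ! i}"

definition spider :: "nat list \<Rightarrow> spider_vertex pair_pre_digraph" where
  "spider ls = \<lparr> pverts = insert Root (leg_verts ls),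
     parcs = (\<Union>v \<in> leg_verts ls. {(v, toward_root v), (toward_root v, v)}) \<rparr>"

lemma leg_verts_Sigma:
  "leg_verts ls = (\<lambda>(i, j). Leg i j) ` (SIGMA i:{..<length ls}. {..<ls ! i})"
  by (auto simp: leg_verts_def)

lemma finite_leg_verts: "finite (leg_verts ls)"
  by (simp add: leg_verts_Sigma)

lemma card_leg_verts: "card (leg_verts ls) = sum_list ls"
proof -
  have "inj_on (\<lambda>(i, j). Leg i j) (SIGMA i:{..<length ls}. {..<ls ! i})"
    by (auto simp: inj_on_def)
  then show ?thesis
    by (simp add: leg_verts_Sigma card_image sum_list_sum_nth atLeast0LessThan)
qed

lemma toward_root_in_spider:
  "v \<in> leg_verts ls \<Longrightarrow> toward_root v \<in> insert Root (leg_verts ls)"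
  by (cases v rule: toward_root.cases) (auto simp: leg_verts_def)

lemma toward_root_neq: "v \<in> leg_verts ls \<Longrightarrow> toward_root v \<noteq> v"
  by (cases v rule: toward_root.cases) (auto simp: leg_verts_def)

lemma pair_graph_spider: "pair_graph (spider ls)"
proof
  show "e \<in> parcs (spider ls) \<Longrightarrow> fst e \<in> pverts (spider ls)" for e
    by (auto simp: spider_def dest: toward_root_in_spider)
  show "e \<in> parcs (spider ls) \<Longrightarrow> snd e \<in> pverts (spider ls)" for e
    by (auto simp: spider_def dest: toward_root_in_spider)
  show "finite (pverts (spider ls))" "finite (parcs (spider ls))"
    by (auto simp: spider_def finite_leg_verts)
  show "e \<in> parcs (spider ls) \<Longrightarrow> fst e \<noteq> snd e" for e
    using toward_root_neq by (fastforce simp: spider_def)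
  show "symmetric (spider ls)"
    by (auto simp: symmetric_def sym_def spider_def)
qed

lemma card_pverts_spider: "card (pverts (spider ls)) = Suc (sum_list ls)"
proof -
  have "Root \<notin> leg_verts ls" by (auto simp: leg_verts_def)
  then show ?thesis
    by (simp add: spider_def finite_leg_verts card_leg_verts)
qed

lemma card_parcs_spider: "card (parcs (spider ls)) = 2 * sum_list ls"
proof -
  let ?A = "(\<lambda>v. (v, toward_root v)) ` leg_verts ls"
  let ?B = "(\<lambda>v. (toward_root v, v)) ` leg_verts ls"
  have loop: "toward_root (toward_root v) \<noteq> v" if "v \<in> leg_verts ls" for v
    using that by (cases v rule: toward_root.cases; cases "toward_root v" rule: toward_root.cases)
      (auto simp: leg_verts_def)
  have "?A \<inter> ?B = {}"
    using loop by auto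
  moreover have "card ?A = sum_list ls" "card ?B = sum_list ls"
    by (simp_all add: card_image inj_on_def card_leg_verts)
  moreover have "parcs (spider ls) = ?A \<union> ?B"
    by (auto simp: spider_def)
  ultimately show ?thesis
    by (simp add: card_Un_disjoint finite_leg_verts)
qed

end

(*
  Write m = k - 1 = a + b + c for the lengths of the three long legs, c being the least. The average
  degree gives a vertex r of degree at least m + 1, and as soon as three legs of lengths a, b, c start
  at r, a further neighbour of r provides the leg of length 1.

  If x and y are adjacent, G is 2-connected and more than (n - 2)(t + 1)/2 edges are different from
  xy, then x and y are joined by a path of length at least t. This goes by induction: some component D
  outside a longest path P is incident with more than |D|(t + 1)/2 edges. Keep the first attachment
  of D on P, identify all the others, and apply the induction hypothesis; the edges lost by the
  identification are paid for by the gaps between the neighbours on P of a single vertex of D.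
  Applied to r and a neighbour, this yields a cycle through r of length more than a + b.

  Take a longest cycle C through r and a component D of the rest that contains a neighbour of r. If D
  is incident with at most |D| m/2 edges, delete it; the graph remains 2-connected. Otherwise D
  contains a set S whose vertices have more than m/2 neighbours in S and on C. A longest path from r
  through D that ends in S is either a leg of length c or has an end with so many neighbours on C that
  one of them lets this path continue along C as a leg, C providing the other two.
*)

theory Submission
  imports Defs
begin


section \<open>Adjacency relations\<close>

definition deg_in :: "('a \<Rightarrow> 'a \<Rightarrow> bool) \<Rightarrow> 'a set \<Rightarrow> 'a \<Rightarrow> nat" where
  "deg_in E X v = card {u \<in> X. E v u}"

text \<open>Ordered adjacent pairs: an edge inside \<open>X\<close> counts twice in
  \<open>pairs E X X\<close>, so that \<open>pairs E V V\<close> is the degree sum and no halves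
  occur.\<close>

definition pairs :: "('a \<Rightarrow> 'a \<Rightarrow> bool) \<Rightarrow> 'a set \<Rightarrow> 'a set \<Rightarrow> nat" where
  "pairs E X Y = (\<Sum>v\<in>X. deg_in E Y v)"

text \<open>Twice the number of edges with at least one end in \<open>D\<close> and the other one in \<open>D \<union> P\<close>.\<close>

definition weight :: "('a \<Rightarrow> 'a \<Rightarrow> bool) \<Rightarrow> 'a set \<Rightarrow> 'a set \<Rightarrow> nat" where
  "weight E D P = pairs E D D + 2 * pairs E D P"

definition spath :: "('a \<Rightarrow> 'a \<Rightarrow> bool) \<Rightarrow> 'a list \<Rightarrow> bool" where
  "spath E xs \<longleftrightarrow> distinct xs \<and> successively E xs"

text \<open>Connectivity by cuts, so that a cut argument needs only one crossing edge. The empty set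
  counts as connected.\<close>

definition conn_set :: "('a \<Rightarrow> 'a \<Rightarrow> bool) \<Rightarrow> 'a set \<Rightarrow> bool" where
  "conn_set E X \<longleftrightarrow>
     (\<forall>U W. U \<union> W = X \<and> U \<inter> W = {} \<and> U \<noteq> {} \<and> W \<noteq> {} \<longrightarrow> (\<exists>u\<in>U. \<exists>w\<in>W. E u w))"

lemma deg_in_Un: "\<lbrakk>finite X; finite Y; X \<inter> Y = {}\<rbrakk> \<Longrightarrow> deg_in E (X \<union> Y) v = deg_in E X v + deg_in E Y v"
  unfolding deg_in_def by (subst card_Un_disjoint[symmetric]) (auto intro: arg_cong[where f = card])

lemma deg_in_mono: "finite Y \<Longrightarrow> X \<subseteq> Y \<Longrightarrow> deg_in E X v \<le> deg_in E Y v"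
  unfolding deg_in_def by (rule card_mono) auto

lemma deg_in_le_card: "finite X \<Longrightarrow> deg_in E X v \<le> card X"
  unfolding deg_in_def by (rule card_mono) auto

lemma pairs_Un_left: "\<lbrakk>finite X; finite Y; X \<inter> Y = {}\<rbrakk> \<Longrightarrow> pairs E (X \<union> Y) Z = pairs E X Z + pairs E Y Z"
  unfolding pairs_def by (rule sum.union_disjoint)

lemma pairs_Un_right:
  "\<lbrakk>finite X; finite Y; X \<inter> Y = {}\<rbrakk> \<Longrightarrow> pairs E Z (X \<union> Y) = pairs E Z X + pairs E Z Y"
  unfolding pairs_def by (simp add: deg_in_Un sum.distrib)

lemma pairs_empty [simp]: "pairs E {} Y = 0" "pairs E X {} = 0"
  by (auto simp: pairs_def deg_in_def)

lemma pairs_eq_0: "(\<And>u v. u \<in> X \<Longrightarrow> v \<in> Y \<Longrightarrow> \<not> E u v) \<Longrightarrow> pairs E X Y = 0"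
proof -
  assume "\<And>u v. u \<in> X \<Longrightarrow> v \<in> Y \<Longrightarrow> \<not> E u v"
  then have "{u \<in> Y. E v u} = {}" if "v \<in> X" for v using that by blast
  then have "deg_in E Y v = 0" if "v \<in> X" for v using that by (simp only: deg_in_def card.empty)
  then show ?thesis by (simp add: pairs_def)
qed

lemma pairs_mult_card: "finite Y \<Longrightarrow> pairs E X Y \<le> card X * card Y"
  unfolding pairs_def using sum_bounded_above[of X "deg_in E Y" "card Y"]
  by (simp add: deg_in_le_card)

lemma weight_empty [simp]: "weight E {} P = 0"
  by (simp add: weight_def)

locale sym_rel =
  fixes E :: "'a \<Rightarrow> 'a \<Rightarrow> bool"
  assumes sym: "E a b \<Longrightarrow> E b a" and irrefl: "\<not> E a a"
begin

lemma sym_iff: "E a b \<longleftrightarrow> E b a"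
  using sym by blast

lemma conversep_eq: "(\<lambda>x y. E y x) = E"
  using sym by blast

lemma spath_rev [simp]: "spath E (rev xs) \<longleftrightarrow> spath E xs"
  unfolding spath_def successively_rev conversep_eq by simp

lemma pairs_commute: "finite X \<Longrightarrow> finite Y \<Longrightarrow> pairs E X Y = pairs E Y X"
proof -
  assume fin: "finite X" "finite Y"
  have "pairs E X Y = (\<Sum>v\<in>X. \<Sum>u\<in>Y. if E v u then 1 else 0)"
    using fin by (auto simp: pairs_def deg_in_def sum.If_cases Int_def intro!: sum.cong arg_cong[where f = card])
  also have "\<dots> = (\<Sum>u\<in>Y. \<Sum>v\<in>X. if E u v then 1 else 0)"
    by (subst sum.swap) (simp add: sym_iff)
  also have "\<dots> = pairs E Y X"
    using fin by (auto simp: pairs_def deg_in_def sum.If_cases Int_def intro!: sum.cong arg_cong[where f = card])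
  finally show ?thesis .
qed

lemma pairs_self_le: "finite X \<Longrightarrow> pairs E X X \<le> card X * (card X - 1)"
proof -
  assume fin: "finite X"
  have "deg_in E X v \<le> card X - 1" if "v \<in> X" for v
  proof -
    have "{u \<in> X. E v u} \<subseteq> X - {v}" using irrefl by auto
    then show ?thesis unfolding deg_in_def using fin that
      by (metis card_Diff_singleton card_mono finite_Diff)
  qed
  then show ?thesis
    unfolding pairs_def using sum_bounded_above[of X "deg_in E X" "card X - 1"] by simp
qed

lemma pairs_Un_self:
  "\<lbrakk>finite X; finite Y; X \<inter> Y = {}\<rbrakk> \<Longrightarrow>
    pairs E (X \<union> Y) (X \<union> Y) = pairs E X X + pairs E Y Y + 2 * pairs E X Y"
  by (simp add: pairs_Un_left pairs_Un_right pairs_commute[of Y X])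

text \<open>An edge between \<open>X\<close> and \<open>Y\<close> is charged to \<open>Y\<close>
  only, as an edge to the outer set \<open>X \<union> P\<close>.\<close>

lemma weight_Un:
  assumes "finite X" "finite Y" "finite P" "X \<inter> Y = {}" "Y \<inter> P = {}" "X \<inter> P = {}"
  shows "weight E (X \<union> Y) P = weight E X P + weight E Y (X \<union> P)"
  using assms by (simp add: weight_def pairs_Un_self pairs_Un_left pairs_Un_right pairs_commute[of Y X])

lemma weight_Un_no_edges:
  assumes "finite X" "finite Y" "X \<inter> Y = {}" "\<And>u v. u \<in> X \<Longrightarrow> v \<in> Y \<Longrightarrow> \<not> E u v"
  shows "weight E (X \<union> Y) P = weight E X P + weight E Y P"
  using pairs_eq_0[of X Y E] assms(4) pairs_Un_self[OF assms(1-3)] pairs_Un_left[OF assms(1-3)]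
  by (simp add: weight_def)

lemma spath_append:
  assumes "spath E xs" "spath E ys" "set xs \<inter> set ys = {}" "xs \<noteq> []" "ys \<noteq> []" "E (last xs) (hd ys)"
  shows "spath E (xs @ ys)"
  using assms by (auto simp: spath_def successively_append_iff)

section \<open>Connected sets and components\<close>

lemma conn_path_between:
  assumes "conn_set E X" "u \<in> X" "v \<in> X"
  shows "\<exists>xs. spath E xs \<and> set xs \<subseteq> X \<and> xs \<noteq> [] \<and> hd xs = u \<and> last xs = v"
proof -
  define R where "R = {v \<in> X. \<exists>xs. spath E xs \<and> set xs \<subseteq> X \<and> xs \<noteq> [] \<and> hd xs = u \<and> last xs = v}"
  have uR: "u \<in> R"
    using assms(2) by (auto simp: R_def spath_def intro!: exI[of _ "[u]"])
  have "R = X"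
  proof (rule ccontr)
    assume "R \<noteq> X"
    moreover have "R \<subseteq> X" by (auto simp: R_def)
    ultimately obtain a b where ab: "a \<in> R" "b \<in> X - R" "E a b"
      using assms(1)[unfolded conn_set_def, rule_format, of R "X - R"] uR by blast
    then obtain xs where xs: "spath E xs" "set xs \<subseteq> X" "xs \<noteq> []" "hd xs = u" "last xs = a"
      by (auto simp: R_def)
    have "b \<notin> set xs"
    proof
      assume "b \<in> set xs"
      then obtain ys zs where "xs = ys @ b # zs" by (meson split_list)
      then have "spath E (ys @ [b])" "set (ys @ [b]) \<subseteq> X" "hd (ys @ [b]) = u"
        using xs by (auto simp: spath_def successively_append_iff hd_append)
      then have "b \<in> R" using ab(2) unfolding R_def by (auto intro!: exI[of _ "ys @ [b]"])
      with ab(2) show False by simp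
    qed
    then have "spath E (xs @ [b])"
      using xs ab by (auto simp: spath_def successively_append_iff)
    then have "b \<in> R" using ab(2) xs unfolding R_def by (auto intro!: exI[of _ "xs @ [b]"])
    with ab(2) show False by simp
  qed
  with assms(3) show ?thesis by (auto simp: R_def)
qed

text \<open>A largest connected subset of \<open>W\<close> containing \<open>w\<close> is closed: a
  further neighbour in \<open>W\<close> could be added to it.\<close>

lemma component_exists:
  assumes "finite W" "w \<in> W"
  obtains D where "D \<subseteq> W" "w \<in> D" "conn_set E D" "\<And>d v. d \<in> D \<Longrightarrow> v \<in> W - D \<Longrightarrow> \<not> E d v"
proof -
  have "\<exists>D. (D \<subseteq> W \<and> w \<in> D \<and> conn_set E D) \<and>
      (\<forall>D'. D' \<subseteq> W \<and> w \<in> D' \<and> conn_set E D' \<longrightarrow> card D' \<le> card D)"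
  proof (rule ex_has_greatest_nat[where k = "{w}" and b = "Suc (card W)"])
    show "{w} \<subseteq> W \<and> w \<in> {w} \<and> conn_set E {w}"
      using assms unfolding conn_set_def by (auto simp: Un_singleton_iff)
    show "\<forall>D. D \<subseteq> W \<and> w \<in> D \<and> conn_set E D \<longrightarrow> card D < Suc (card W)"
      using assms by (auto simp: less_Suc_eq_le intro: card_mono)
  qed
  then obtain D where D: "D \<subseteq> W" "w \<in> D" "conn_set E D"
    and mx: "\<forall>D'. D' \<subseteq> W \<and> w \<in> D' \<and> conn_set E D' \<longrightarrow> card D' \<le> card D"
    by (elim exE conjE)
  have "\<not> E d v" if "d \<in> D" "v \<in> W - D" for d v
  proof
    assume dv: "E d v"
    have "conn_set E (insert v D)"
      unfolding conn_set_def
    proof (intro allI impI, elim conjE)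
      fix U Z assume UZ: "U \<union> Z = insert v D" "U \<inter> Z = {}" "U \<noteq> {}" "Z \<noteq> {}"
      show "\<exists>u\<in>U. \<exists>w\<in>Z. E u w"
      proof (cases "U - {v} = {} \<or> Z - {v} = {}")
        case True
        then have "U = {v} \<or> Z = {v}" using UZ by auto
        then show ?thesis
        proof
          assume "U = {v}"
          moreover from this UZ that have "d \<in> Z" by auto
          ultimately show ?thesis using dv sym by blast
        next
          assume "Z = {v}"
          moreover from this UZ that have "d \<in> U" by auto
          ultimately show ?thesis using dv by blast
        qed
      next
        case False
        moreover have "(U - {v}) \<union> (Z - {v}) = D" using UZ that by auto
        moreover have "(U - {v}) \<inter> (Z - {v}) = {}" using UZ by auto
        ultimately show ?thesis
          using D(3)[unfolded conn_set_def, rule_format, of "U - {v}" "Z - {v}"] by blast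
      qed
    qed
    with mx[rule_format, of "insert v D"] D that have "card (insert v D) \<le> card D" by auto
    moreover have "finite D" using D(1) assms(1) finite_subset by blast
    ultimately show False using that by auto
  qed
  with D that show ?thesis by blast
qed

text \<open>A path inside \<open>D\<close> from \<open>hd R\<close> to \<open>v\<close> is cut at
  its last vertex \<open>d\<close> on \<open>R\<close>; the remainder \<open>W\<close> avoids
  \<open>R\<close>.\<close>

lemma conn_path_to_set:
  assumes "conn_set E D" "v \<in> D" "set R \<subseteq> D" "R \<noteq> []"
  obtains Ra d Rb W where "R = Ra @ d # Rb" "spath E (d # W)" "set W \<subseteq> D" "last (d # W) = v"
    "set W \<inter> set R = {}"
proof -
  have "hd R \<in> D" using assms(3,4) by (auto dest: hd_in_set)
  from conn_path_between[OF assms(1) this assms(2)]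
  obtain xs where xs: "spath E xs" "set xs \<subseteq> D" "xs \<noteq> []" "hd xs = hd R" "last xs = v"
    by blast
  have "hd R \<in> set xs" "hd R \<in> set R"
    using xs(3) assms(4) hd_in_set[of R] hd_in_set[of xs] unfolding xs(4) by blast+
  then have "\<exists>x\<in>set xs. x \<in> set R" by blast
  then obtain ys d W where sp: "xs = ys @ d # W" "d \<in> set R" "\<forall>z\<in>set W. z \<notin> set R"
    using split_list_last_prop[of xs "\<lambda>z. z \<in> set R"] by blast
  from split_list[OF sp(2)] obtain Ra Rb where "R = Ra @ d # Rb" by blast
  moreover have "spath E (d # W)" using xs sp by (auto simp: spath_def successively_append_iff)
  ultimately show ?thesis using that[of Ra d Rb W] sp xs by auto
qed

lemma successively_crossing:
  assumes "successively E xs" "a \<in> set xs" "a \<in> U" "b \<in> set xs" "b \<notin> U"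
  obtains u w where "u \<in> set xs" "u \<in> U" "w \<in> set xs" "w \<notin> U" "E u w"
proof -
  have "\<exists>u w. u \<in> set xs \<and> u \<in> U \<and> w \<in> set xs \<and> w \<notin> U \<and> E u w"
    using assms
  proof (induction xs arbitrary: a b)
    case (Cons x xs)
    show ?case
    proof (cases "(\<exists>a\<in>set xs. a \<in> U) \<and> (\<exists>b\<in>set xs. b \<notin> U)")
      case True
      with Cons.IH Cons.prems(1) show ?thesis by (fastforce simp: successively_Cons)
    next
      case False
      then have ne: "xs \<noteq> []" using Cons.prems by auto
      then have e: "E x (hd xs)" using Cons.prems by (simp add: successively_Cons)
      have h: "hd xs \<in> set xs" using ne by simp
      have "(x \<in> U) \<noteq> (hd xs \<in> U)" using False Cons.prems h by auto
      with e h sym[OF e] show ?thesis by (cases "x \<in> U") auto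
    qed
  qed simp
  with that show ?thesis by blast
qed

end

text \<open>\<open>N\<close> and its shift by one are disjoint subsets of
  \<open>{lo..hi}\<close>.\<close>

lemma card_spaced_le:
  fixes N :: "nat set"
  assumes "N \<subseteq> {lo..<hi}" "\<And>i. i \<in> N \<Longrightarrow> Suc i \<notin> N"
  shows "2 * card N \<le> Suc hi - lo"
proof -
  have fin: "finite N" using assms(1) finite_subset by blast
  have "card (N \<union> Suc ` N) = card N + card (Suc ` N)"
    using fin assms(2) by (intro card_Un_disjoint) auto
  also have "\<dots> = 2 * card N" by (simp add: card_image)
  finally have "2 * card N = card (N \<union> Suc ` N)" ..
  also have "\<dots> \<le> card {lo..<Suc hi}"
    using assms(1) by (intro card_mono) auto
  finally show ?thesis by simp
qed


section \<open>Long paths between two given vertices\<close>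

text \<open>
  For \<open>P = {x, y}\<close> this says that adding the edge \<open>xy\<close> to the graph on \<open>D \<union> P\<close> makes it 2-connected.
\<close>

definition two_attached :: "('a \<Rightarrow> 'a \<Rightarrow> bool) \<Rightarrow> 'a set \<Rightarrow> 'a set \<Rightarrow> bool" where
  "two_attached E D P \<longleftrightarrow> (\<forall>U\<subseteq>D. U \<noteq> {} \<longrightarrow>
     (\<exists>p\<in>(D \<union> P) - U. \<exists>q\<in>(D \<union> P) - U. p \<noteq> q \<and> (\<exists>u\<in>U. E u p) \<and> (\<exists>u\<in>U. E u q)))"

lemma two_attachedE:
  assumes "two_attached E D P" "U \<subseteq> D" "U \<noteq> {}"
  obtains p q where "p \<in> D \<union> P" "p \<notin> U" "q \<in> D \<union> P" "q \<notin> U" "p \<noteq> q"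
    "\<exists>u\<in>U. E u p" "\<exists>u\<in>U. E u q"
proof -
  from assms(1)[unfolded two_attached_def, rule_format, OF assms(2,3)]
  obtain p q where "p \<in> D \<union> P - U" "q \<in> D \<union> P - U" "p \<noteq> q" "\<exists>u\<in>U. E u p" "\<exists>u\<in>U. E u q"
    by blast
  then show thesis by (intro that[of p q]) auto
qed

section \<open>Detours of a longest path with fixed ends\<close>

definition longest_path_in :: "('a \<Rightarrow> 'a \<Rightarrow> bool) \<Rightarrow> 'a set \<Rightarrow> 'a list \<Rightarrow> bool" where
  "longest_path_in E V P \<longleftrightarrow> spath E P \<and> set P \<subseteq> V \<and>
     (\<forall>P'. spath E P' \<and> set P' \<subseteq> V \<and> hd P' = hd P \<and> last P' = last P \<longrightarrow> length P' \<le> length P)"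

context sym_rel
begin

text \<open>Replacing the vertices strictly between positions \<open>i\<close> and \<open>j\<close>
  by \<open>Q\<close> gives a path with the same ends, which cannot be longer than
  \<open>P\<close>.\<close>

lemma detour_gap:
  assumes P: "longest_path_in E V P" and ij: "i < j" "j < length P"
    and Q: "spath E Q" "Q \<noteq> []" "set Q \<subseteq> V - set P"
    and ends: "E (P ! i) (hd Q)" "E (last Q) (P ! j)"
  shows "length Q + 1 \<le> j - i"
proof -
  let ?P = "take (Suc i) P @ Q @ drop j P"
  have P': "spath E P" "set P \<subseteq> V" using P by (auto simp: longest_path_in_def)
  have tn: "take (Suc i) P \<noteq> []" "drop j P \<noteq> []" using ij by auto
  have sub: "set (take (Suc i) P) \<subseteq> set P" "set (drop j P) \<subseteq> set P"
    by (auto dest: in_set_takeD in_set_dropD)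
  have l: "last (take (Suc i) P) = P ! i" using ij by (simp add: take_Suc_conv_app_nth)
  have d: "hd (drop j P) = P ! j" using ij by (simp add: hd_drop_conv_nth)
  have dist: "set (take (Suc i) P) \<inter> set (drop j P) = {}"
    using P'(1) ij by (intro set_take_disj_set_drop_if_distinct) (auto simp: spath_def)
  have "successively E (take (Suc i) P)" "successively E (drop j P)"
    using P'(1) append_take_drop_id[of "Suc i" P] append_take_drop_id[of j P]
    unfolding spath_def by (metis successively_append_iff)+
  then have s1: "spath E (take (Suc i) P)" "spath E (drop j P)"
    using P'(1) by (auto simp: spath_def)
  have "spath E (Q @ drop j P)"
    using Q s1 tn sub d ends by (subst spath_append) auto
  moreover have "set (take (Suc i) P) \<inter> set (Q @ drop j P) = {}"
    using Q(3) sub dist by auto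
  ultimately have "spath E ?P"
    using s1 tn l ends Q(2) by (subst spath_append) auto
  moreover have "set ?P \<subseteq> V" using Q(3) sub P'(2) by auto
  moreover have "hd ?P = hd P" using ij by (cases P) auto
  moreover have "last ?P = last P" using ij by (simp add: last_append)
  ultimately have "length ?P \<le> length P"
    using P unfolding longest_path_in_def by blast
  then show ?thesis using ij by simp
qed

text \<open>
  The key estimate: a detour \<open>R\<close> through \<open>D\<close> and the neighbours of a single vertex \<open>v\<close> of \<open>D\<close>
  occupy different portions of the longest path. Between the ends of \<open>R\<close>, a neighbour of \<open>v\<close>
  has to keep its distance from both ends, because \<open>v\<close> is linked to \<open>R\<close> inside \<open>D\<close>.
\<close>

lemma detour_and_neighbours:
  assumes P: "longest_path_in E V P" and D: "D \<subseteq> V - set P" "conn_set E D"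
    and ij: "i < j" "j < length P"
    and R: "spath E R" "R \<noteq> []" "set R \<subseteq> D" "E (P ! i) (hd R)" "E (last R) (P ! j)"
    and v: "v \<in> D" and N: "N = {h \<in> {i<..<length P}. E v (P ! h)}"
  shows "length R + 2 * card N \<le> length P - i"
proof -
  have gapR: "length R + 1 \<le> j - i"
    using detour_gap[OF P ij R(1,2) _ R(4,5)] R(3) D(1) by blast
  have spaced: "Suc h \<notin> N" if "h \<in> N" for h
  proof
    assume "Suc h \<in> N"
    then have "length [v] + 1 \<le> Suc h - h"
      using that v D(1) N sym by (intro detour_gap[OF P]) (auto simp: spath_def)
    then show False by simp
  qed
  obtain Ra d Rb W where W: "R = Ra @ d # Rb" "spath E (d # W)" "set W \<subseteq> D" "last (d # W) = v"
    "set W \<inter> set R = {}"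
    using conn_path_to_set[OF D(2) v R(3,2)] by blast
  \<comment> \<open>A detour from \<open>P ! i\<close> along \<open>Ra\<close>, \<open>d\<close> and
    \<open>W\<close> to a neighbour \<open>P ! h\<close> of \<open>v\<close> has at least
    \<open>length Ra + 1\<close> vertices. This gives \<open>?l\<close>, and the mirror image gives
    \<open>?r\<close>.\<close>
  let ?l = "i + length Ra + 2" and ?r = "j - length Rb - 1"
  have inner: "N \<inter> {..<j} \<subseteq> {?l..<?r}"
  proof
    fix h assume h: "h \<in> N \<inter> {..<j}"
    then have hN: "i < h" "h < length P" "E v (P ! h)" "h < j" by (auto simp: N)
    have "spath E (Ra @ d # W)"
      using W(1,2,5) R(1) by (auto simp: spath_def successively_append_iff)
    moreover have "set (Ra @ d # W) \<subseteq> V - set P" using W R(3) D(1) by auto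
    moreover have "E (P ! i) (hd (Ra @ d # W))" using R(4) W(1) by (cases Ra) auto
    moreover have "last (Ra @ d # W) = v" using W(4) by simp
    ultimately have a: "length (Ra @ d # W) + 1 \<le> h - i"
      using hN by (intro detour_gap[OF P]) auto
    \<comment> \<open>The mirror image: back from \<open>P ! j\<close> along \<open>Rb\<close> to
      \<open>d\<close>, then along \<open>W\<close> to \<open>v\<close>. Reversed, it is a detour
      from \<open>P ! h\<close> to \<open>P ! j\<close>.\<close>
    have "spath E (rev (Rb) @ d # W)"
    proof -
      have "spath E (rev Rb @ d # rev Ra)" using R(1) W(1) spath_rev[of R] by simp
      then show ?thesis using W(1,2,5) by (auto simp: spath_def successively_append_iff)
    qed
    moreover have "E (P ! j) (hd (rev Rb @ d # W))" using R(5) W(1) sym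
      by (cases Rb rule: rev_cases) (auto simp: hd_append)
    moreover have "last (rev Rb @ d # W) = v" using W(4) by simp
    moreover have "set (rev Rb @ d # W) \<subseteq> V - set P" using W R(3) D(1) by auto
    moreover have "length (rev (rev Rb @ d # W)) + 1 \<le> j - h"
    proof (rule detour_gap[OF P hN(4) ij(2)])
      show "spath E (rev (rev Rb @ d # W))"
        unfolding spath_rev by fact
      show "set (rev (rev Rb @ d # W)) \<subseteq> V - set P"
        unfolding set_rev by fact
      show "E (P ! h) (hd (rev (rev Rb @ d # W)))"
        unfolding hd_rev using \<open>last (rev Rb @ d # W) = v\<close> hN(3) sym by simp
      show "E (last (rev (rev Rb @ d # W))) (P ! j)"
        unfolding last_rev using \<open>E (P ! j) (hd (rev Rb @ d # W))\<close> sym by simp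
    qed simp
    ultimately show "h \<in> {?l..<?r}" using a hN by auto
  qed
  have finN: "finite N" by (simp add: N)
  have "2 * card (N \<inter> {..<j}) \<le> Suc ?r - ?l"
    using inner spaced by (intro card_spaced_le) auto
  \<comment> \<open>By \<open>gapR\<close>, the truncated difference \<open>Suc ?r - ?l\<close> is
    really \<open>j - i - length R - 1\<close>.\<close>
  then have c1: "length R + 1 + 2 * card (N \<inter> {..<j}) \<le> j - i"
    using gapR W(1) by auto
  have "2 * card (N \<inter> {j..}) \<le> Suc (length P) - j"
    using spaced by (intro card_spaced_le) (auto simp: N)
  moreover have "card N = card (N \<inter> {..<j}) + card (N \<inter> {j..})"
    using finN by (subst card_Un_disjoint[symmetric]) (auto intro: arg_cong[where f = card])
  ultimately show ?thesis using c1 ij by linarith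
qed

end


text \<open>All vertices of \<open>S\<close> are identified with \<open>q\<close>, and \<open>p\<close> is joined to \<open>q\<close>.\<close>

definition merged :: "('a \<Rightarrow> 'a \<Rightarrow> bool) \<Rightarrow> 'a set \<Rightarrow> 'a set \<Rightarrow> 'a \<Rightarrow> 'a \<Rightarrow> 'a \<Rightarrow> 'a \<Rightarrow> bool" where
  "merged E D S p q a b \<longleftrightarrow>
     (a \<in> D \<and> b \<in> D \<and> E a b) \<or> (a = p \<and> b = q) \<or> (a = q \<and> b = p) \<or>
     (a \<in> D \<and> (b = p \<and> E a p \<or> b = q \<and> (\<exists>s\<in>S. E a s))) \<or>
     (b \<in> D \<and> (a = p \<and> E b p \<or> a = q \<and> (\<exists>s\<in>S. E b s)))"

section \<open>Weight and attachment after an identification\<close>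

context sym_rel
begin

lemma merged_sym_rel:
  assumes "p \<notin> D" "q \<notin> D" "p \<noteq> q"
  shows "sym_rel (merged E D S p q)"
proof
  show "merged E D S p q a b \<Longrightarrow> merged E D S p q b a" for a b
    unfolding merged_def using sym by blast
  show "\<not> merged E D S p q a a" for a
    using assms irrefl by (auto simp: merged_def)
qed

text \<open>The identification costs a vertex of \<open>D\<close> at most \<open>M\<close> of its
  neighbours in \<open>P\<close>, and the weight counts edges to \<open>P\<close> twice.\<close>

lemma merged_weight:
  assumes "p \<notin> D" "q \<notin> D" "p \<noteq> q" "finite D"
    and M: "\<And>v. v \<in> D \<Longrightarrow> deg_in E P v \<le> of_bool (E v p) + of_bool (\<exists>s\<in>S. E v s) + M"
  shows "weight E D P \<le> weight (merged E D S p q) D {p, q} + 2 * M * card D"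
proof -
  let ?E = "merged E D S p q"
  have "deg_in ?E D v = deg_in E D v" if "v \<in> D" for v
  proof -
    have "{u \<in> D. ?E v u} = {u \<in> D. E v u}" using that assms(1-3) by (auto simp: merged_def)
    then show ?thesis by (simp add: deg_in_def)
  qed
  then have DD: "pairs ?E D D = pairs E D D" by (simp add: pairs_def)
  have "deg_in ?E {p, q} v = of_bool (E v p) + of_bool (\<exists>s\<in>S. E v s)" if "v \<in> D" for v
  proof -
    have "?E v p \<longleftrightarrow> E v p" "?E v q \<longleftrightarrow> (\<exists>s\<in>S. E v s)"
      using that assms(1-3) by (auto simp: merged_def)
    then have "{u \<in> {p, q}. ?E v u} = (if E v p then {p} else {}) \<union> (if \<exists>s\<in>S. E v s then {q} else {})"
      by auto
    then show ?thesis using assms(3) unfolding deg_in_def by simp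
  qed
  then have "pairs E D P \<le> (\<Sum>v\<in>D. deg_in ?E {p, q} v + M)"
    unfolding pairs_def using M by (intro sum_mono) simp
  also have "\<dots> = pairs ?E D {p, q} + M * card D"
    by (simp add: pairs_def sum.distrib)
  finally show ?thesis by (simp add: weight_def DD)
qed

text \<open>The identification might make the two outer neighbours of \<open>U\<close> coincide. For
  \<open>U \<noteq> D\<close>, connectedness provides one of them inside \<open>D\<close>, where
  nothing is identified; for \<open>U = D\<close> they are \<open>p\<close> and
  \<open>q\<close>.\<close>

lemma merged_two_attached:
  assumes att: "two_attached E D S" and D: "conn_set E D" "D \<inter> S = {}"
    and p: "p \<in> S" "\<exists>d\<in>D. E d p" and S: "\<exists>d\<in>D. \<exists>s\<in>S - {p}. E d s" and q: "q \<notin> D" "p \<noteq> q"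
  shows "two_attached (merged E D (S - {p}) p q) D {p, q}"
  unfolding two_attached_def
proof (intro allI impI)
  let ?E = "merged E D (S - {p}) p q"
  fix U assume U: "U \<subseteq> D" "U \<noteq> {}"
  have pD: "p \<notin> D" using p D by auto
  have inD: "?E u d" if "u \<in> U" "d \<in> D" "E u d" for u d
    using that U by (auto simp: merged_def)
  have outp: "?E u p" if "u \<in> U" "E u p" for u using that U by (auto simp: merged_def)
  have outq: "?E u q" if "u \<in> U" "s \<in> S" "s \<noteq> p" "E u s" for u s
    using that U by (auto simp: merged_def)
  show "\<exists>a\<in>D \<union> {p, q} - U. \<exists>b\<in>D \<union> {p, q} - U. a \<noteq> b \<and> (\<exists>u\<in>U. ?E u a) \<and> (\<exists>u\<in>U. ?E u b)"
  proof (cases "U = D")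
    case True
    then have "\<exists>u\<in>U. ?E u p" "\<exists>u\<in>U. ?E u q" using p S outp outq by blast+
    with True pD q show ?thesis by (intro bexI[of _ p] bexI[of _ q]) auto
  next
    case False
    with U obtain u d where ud: "u \<in> U" "d \<in> D - U" "E u d"
      using D(1)[unfolded conn_set_def, rule_format, of U "D - U"] by blast
    obtain a where a: "a \<in> D \<union> S" "a \<notin> U" "a \<noteq> d" "\<exists>u\<in>U. E u a"
    proof -
      obtain a b where "a \<in> D \<union> S" "a \<notin> U" "b \<in> D \<union> S" "b \<notin> U" "a \<noteq> b"
        "\<exists>u\<in>U. E u a" "\<exists>u\<in>U. E u b"
        using two_attachedE[OF att U] .
      then show thesis by (cases "a = d") (use that in auto)
    qed
    then obtain u' where u': "u' \<in> U" "E u' a" by blast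
    have "\<exists>b\<in>D \<union> {p, q} - U. b \<noteq> d \<and> ?E u' b"
    proof (cases "a \<in> D")
      case True
      with a u' inD show ?thesis by (intro bexI[of _ a]) auto
    next
      case False
      with a(1) have "a \<in> S" by simp
      show ?thesis
      proof (cases "a = p")
        case True
        with u' outp ud pD U show ?thesis by (intro bexI[of _ p]) auto
      next
        case False
        with \<open>a \<in> S\<close> u' outq ud q U show ?thesis by (intro bexI[of _ q]) auto
      qed
    qed
    then obtain b where "b \<in> D \<union> {p, q} - U" "b \<noteq> d" "?E u' b" by blast
    moreover have "?E u d" using ud inD by blast
    ultimately show ?thesis
      using ud u'(1) by (intro bexI[of _ d] bexI[of _ b]) auto
  qed
qed

text \<open>A component of \<open>D\<close> has two outer neighbours, which can only be
  \<open>x\<close> and \<open>y\<close>; a path through the component joins them.\<close>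

lemma path_through_exists:
  assumes "finite D" "D \<noteq> {}" "x \<notin> D" "y \<notin> D" "x \<noteq> y" "two_attached E D {x, y}"
  shows "\<exists>P. spath E P \<and> set P \<subseteq> D \<union> {x, y} \<and> hd P = x \<and> last P = y \<and> 3 \<le> length P"
proof -
  obtain w where "w \<in> D" using assms(2) by blast
  obtain C where C: "C \<subseteq> D" "w \<in> C" "conn_set E C" "\<And>d v. d \<in> C \<Longrightarrow> v \<in> D - C \<Longrightarrow> \<not> E d v"
    using component_exists[OF assms(1) \<open>w \<in> D\<close>] by metis
  have "C \<noteq> {}" using C by blast
  obtain p q where pq: "p \<in> D \<union> {x, y}" "p \<notin> C" "q \<in> D \<union> {x, y}" "q \<notin> C" "p \<noteq> q"
    "\<exists>u\<in>C. E u p" "\<exists>u\<in>C. E u q"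
    using two_attachedE[OF assms(6) C(1) \<open>C \<noteq> {}\<close>] .
  then have "p \<in> {x, y}" "q \<in> {x, y}" using C(4) by blast+
  with pq obtain a b where ab: "a \<in> C" "b \<in> C" "E x a" "E b y" using sym by blast
  obtain Q where Q: "spath E Q" "set Q \<subseteq> C" "Q \<noteq> []" "hd Q = a" "last Q = b"
    using conn_path_between[OF C(3) ab(1,2)] by blast
  have "spath E (x # Q @ [y])"
    using Q ab C(1) assms(3-5) by (auto simp: spath_def successively_Cons successively_append_iff)
  moreover have "length (x # Q @ [y]) \<ge> 3" using Q(3) by (cases Q) auto
  ultimately show ?thesis using Q(2) C(1) by (intro exI[of _ "x # Q @ [y]"]) auto
qed

lemma longest_path_exists:
  assumes "finite V" "spath E P0" "set P0 \<subseteq> V"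
  obtains P where "longest_path_in E V P" "hd P = hd P0" "last P = last P0" "length P0 \<le> length P"
proof -
  let ?Q = "\<lambda>P. spath E P \<and> set P \<subseteq> V \<and> hd P = hd P0 \<and> last P = last P0"
  have "\<forall>P. ?Q P \<longrightarrow> length P < Suc (card V)"
    using assms(1) unfolding spath_def less_Suc_eq_le by (metis card_mono distinct_card)
  with assms(2,3) have "\<exists>P. ?Q P \<and> (\<forall>P'. ?Q P' \<longrightarrow> length P' \<le> length P)"
    by (intro ex_has_greatest_nat[where k = P0 and b = "Suc (card V)"]) auto
  then obtain P where P: "?Q P" "\<forall>P'. ?Q P' \<longrightarrow> length P' \<le> length P" by blast
  have "longest_path_in E V P" unfolding longest_path_in_def using P by auto
  with P assms that show thesis by auto
qed

text \<open>Among the closed subsets of \<open>T\<close> that are too heavy, a smallest one is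
  connected: if it split without crossing edges, weights and sizes would add up, and one part would
  be too heavy as well.\<close>

lemma rich_component:
  assumes "finite T" "T \<inter> S = {}" "card T * m < weight E T S"
  obtains D where "D \<subseteq> T" "D \<noteq> {}" "conn_set E D" "card D * m < weight E D S"
    "\<And>d v. d \<in> D \<Longrightarrow> v \<in> T - D \<Longrightarrow> \<not> E d v"
proof -
  let ?Q = "\<lambda>D. D \<subseteq> T \<and> card D * m < weight E D S \<and> (\<forall>d\<in>D. \<forall>v\<in>T - D. \<not> E d v)"
  obtain D where D: "?Q D" "\<forall>D'. ?Q D' \<longrightarrow> card D \<le> card D'"
    using ex_has_least_nat[of ?Q T card] assms(3) by auto
  have fin: "finite D" using D assms(1) finite_subset by blast
  have "conn_set E D"
    unfolding conn_set_def
  proof (intro allI impI, elim conjE, rule ccontr)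
    fix U W assume UW: "U \<union> W = D" "U \<inter> W = {}" "U \<noteq> {}" "W \<noteq> {}" and no: "\<not> (\<exists>u\<in>U. \<exists>w\<in>W. E u w)"
    have finUW: "finite U" "finite W" using UW(1) fin by auto
    have cl: "\<forall>d\<in>U. \<forall>v\<in>T - U. \<not> E d v" "\<forall>d\<in>W. \<forall>v\<in>T - W. \<not> E d v"
      using no D(1) UW sym by blast+
    have "card U < card D" "card W < card D"
      using UW fin by (auto intro!: psubset_card_mono)
    then have "\<not> ?Q U" "\<not> ?Q W" using D(2) by (meson not_le)+
    then have "weight E U S \<le> card U * m" "weight E W S \<le> card W * m"
      using cl UW(1) D(1) by auto
    moreover have "weight E D S = weight E U S + weight E W S"
      using weight_Un_no_edges[of U W S] finUW UW no by auto
    moreover have "card D = card U + card W"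
      using UW finUW by (metis card_Un_disjoint)
    ultimately show False using D(1) by (simp add: add_mult_distrib)
  qed
  moreover have "D \<noteq> {}" using D(1) by auto
  ultimately show thesis using that D(1) by blast
qed

end

section \<open>Long paths by induction on the number of inner vertices\<close>

lemma deg_in_set_conv_nth:
  assumes "distinct P"
  shows "deg_in E (set P) v = card {h. h < length P \<and> E v (P ! h)}"
proof -
  have "{u \<in> set P. E v u} = (\<lambda>h. P ! h) ` {h. h < length P \<and> E v (P ! h)}"
    by (auto simp: in_set_conv_nth)
  moreover have "inj_on (\<lambda>h. P ! h) {h. h < length P \<and> E v (P ! h)}"
    using assms by (auto simp: inj_on_def nth_eq_iff_index_eq)
  ultimately show ?thesis by (simp add: deg_in_def card_image)
qed

text \<open>\<open>length P\<close> counts vertices, so the path has at least \<open>t\<close>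
  edges. The relation \<open>E\<close> varies in the induction because the hypothesis is applied to
  a \<open>merged\<close> relation.\<close>

lemma long_path_between:
  fixes E :: "'a \<Rightarrow> 'a \<Rightarrow> bool"
  assumes "sym_rel E" "finite D" "x \<notin> D" "y \<notin> D" "x \<noteq> y" "E x y"
    and "two_attached E D {x, y}" "card D * Suc t < weight E D {x, y}"
  shows "\<exists>P. spath E P \<and> set P \<subseteq> D \<union> {x, y} \<and> hd P = x \<and> last P = y \<and>
    3 \<le> length P \<and> t < length P"
  using assms
proof (induction "card D" arbitrary: E D x y t rule: less_induct)
  case less
  interpret sym_rel E by (rule less.prems(1))
  let ?V = "D \<union> {x, y}"
  note fin = less.prems(2) and xy = less.prems(3-6)
  have "D \<noteq> {}" using less.prems(8) by auto
  then obtain P0 where P0: "spath E P0" "set P0 \<subseteq> ?V" "hd P0 = x" "last P0 = y" "3 \<le> length P0"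
    using path_through_exists[OF fin _ xy(1-3) less.prems(7)] by blast
  obtain P where lP: "longest_path_in E ?V P" and hdP: "hd P = x" "last P = y" and P3: "3 \<le> length P"
    using longest_path_exists[OF _ P0(1,2)] P0(3-5) fin by (metis finite.emptyI finite.insertI finite_UnI le_trans)
  have P: "distinct P" "set P \<subseteq> ?V" using lP by (auto simp: longest_path_in_def spath_def)
  have "t < length P"
  proof (rule ccontr)
    assume "\<not> t < length P"
    then have short: "length P \<le> t" by simp
    have "P \<noteq> []" using P3 by auto
    then have xyP: "x \<in> set P" "y \<in> set P" using hdP hd_in_set last_in_set by blast+
    define I where "I = set P - {x, y}"
    define T where "T = D - set P"
    have finIT: "finite I" "finite T" using fin by (auto simp: I_def T_def)
    have DIT: "D = I \<union> T" "I \<inter> T = {}" and SI: "set P = I \<union> {x, y}"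
      using P xyP xy by (auto simp: I_def T_def)
    have cI: "card I + 2 = length P"
    proof -
      have "card (set P) = card I + card {x, y}"
        unfolding SI using finIT by (intro card_Un_disjoint) (auto simp: I_def)
      then show ?thesis using P(1) xy(3) by (simp add: distinct_card)
    qed
    \<comment> \<open>Each inner vertex of the short path contributes at most
      \<open>length P + 1 \<le> Suc t\<close>, so the excess weight must lie in
      \<open>T\<close>.\<close>
    have "weight E I {x, y} \<le> card I * (card I - 1) + 2 * (card I * 2)"
      unfolding weight_def using pairs_self_le[OF finIT(1)] pairs_mult_card[of "{x, y}" E I] xy(3)
      by (intro add_mono mult_le_mono) auto
    also have "\<dots> = card I * (card I - 1 + 4)" by (simp add: algebra_simps)
    also have "\<dots> \<le> card I * Suc t" using cI short P3 by (intro mult_le_mono2) linarith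
    finally have wI: "weight E I {x, y} \<le> card I * Suc t" .
    have "weight E D {x, y} = weight E I {x, y} + weight E T (set P)"
      unfolding DIT(1) SI using finIT DIT(2) xy by (intro weight_Un) (auto simp: I_def T_def)
    moreover have "card D = card I + card T"
      unfolding DIT(1) using finIT DIT(2) by (rule card_Un_disjoint)
    ultimately have "card T * Suc t < weight E T (set P)"
      using wI less.prems(8) by (simp add: add_mult_distrib)
    moreover have "T \<inter> set P = {}" by (auto simp: T_def)
    ultimately obtain C where C: "C \<subseteq> T" "C \<noteq> {}" "conn_set E C"
      "card C * Suc t < weight E C (set P)" "\<And>d v. d \<in> C \<Longrightarrow> v \<in> T - C \<Longrightarrow> \<not> E d v"
      using rich_component[OF finIT(2)] by metis
    have CD: "C \<subseteq> D" "C \<inter> set P = {}" "C \<subseteq> ?V - set P" using C(1) by (auto simp: T_def)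
    have finC: "finite C" using CD(1) fin finite_subset by blast
    have "I \<noteq> {}" using cI P3 by auto
    then have "C \<subset> D" using C(1) DIT by auto
    then have cC: "card C < card D" using fin by (rule psubset_card_mono[rotated])
    have att: "two_attached E C (set P)"
      unfolding two_attached_def
    proof (intro allI impI)
      fix U assume U: "U \<subseteq> C" "U \<noteq> {}"
      obtain p q where pq: "p \<in> ?V" "p \<notin> U" "q \<in> ?V" "q \<notin> U" "p \<noteq> q"
        "\<exists>u\<in>U. E u p" "\<exists>u\<in>U. E u q"
        using two_attachedE[OF less.prems(7) subset_trans[OF U(1) CD(1)] U(2)] .
      have cl: "r \<in> C \<union> set P" if "r \<in> ?V" "\<exists>u\<in>U. E u r" for r
        using that C(5) U(1) xyP by (auto simp: T_def)
      show "\<exists>p\<in>C \<union> set P - U. \<exists>q\<in>C \<union> set P - U. p \<noteq> q \<and> (\<exists>u\<in>U. E u p) \<and> (\<exists>u\<in>U. E u q)"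
        using pq cl[OF pq(1,6)] cl[OF pq(3,7)] by (intro bexI[of _ p] bexI[of _ q]) auto
    qed
    define A where "A = {h. h < length P \<and> (\<exists>d\<in>C. E d (P ! h))}"
    obtain p q where pq: "p \<in> set P" "q \<in> set P" "p \<noteq> q" "\<exists>u\<in>C. E u p" "\<exists>u\<in>C. E u q"
      using two_attachedE[OF att order_refl C(2)] by (metis UnE)
    then obtain h1 h2 where h12: "h1 \<in> A" "h2 \<in> A" "h1 \<noteq> h2"
      by (auto simp: A_def in_set_conv_nth)
    \<comment> \<open>With the first attachment as \<open>p\<close>, all other neighbours that
      vertices of \<open>C\<close> have on \<open>P\<close> come later and are recorded by
      \<open>N\<close>.\<close>
    define i where "i = Min A"
    have finA: "finite A" by (auto simp: A_def)
    have iA: "i \<in> A" and imin: "\<And>h. h \<in> A \<Longrightarrow> i \<le> h"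
      using finA h12 by (auto simp: i_def intro: Min_in)
    obtain h where h: "h \<in> A" "h \<noteq> i" using h12 by metis
    define N where "N v = {h \<in> {i<..<length P}. E v (P ! h)}" for v
    define p where "p = P ! i"
    \<comment> \<open>Any second attachment; it lends its name to the vertex that replaces all of
      \<open>S\<close>.\<close>
    define q where "q = P ! h"
    define S where "S = set P - {p}"
    have ilen: "i < length P" "h < length P" "i < h"
      using iA h imin[OF h(1)] by (auto simp: A_def)
    have pS: "p \<in> set P" "q \<in> set P" "p \<noteq> q" "p \<notin> C" "q \<notin> C"
      using ilen P(1) CD(2) by (auto simp: p_def q_def nth_eq_iff_index_eq)
    have N_iff: "(\<exists>s\<in>S. E v s) \<longleftrightarrow> N v \<noteq> {}" if "v \<in> C" for v
    proof -
      have "(\<exists>s\<in>S. E v s) \<longleftrightarrow> (\<exists>g<length P. g \<noteq> i \<and> E v (P ! g))"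
        unfolding S_def p_def using ilen P(1) by (auto simp: in_set_conv_nth Bex_def nth_eq_iff_index_eq)
      also have "\<dots> \<longleftrightarrow> N v \<noteq> {}"
        using that imin by (fastforce simp: N_def A_def)
      finally show ?thesis .
    qed
    have finN: "finite (N v)" for v by (simp add: N_def)
    have degP: "deg_in E (set P) v = of_bool (E v p) + card (N v)" if "v \<in> C" for v
    proof -
      have "g = i \<or> i < g" if "g < length P" "E v (P ! g)" for g
      proof -
        have "g \<in> A" using that \<open>v \<in> C\<close> by (auto simp: A_def)
        then show ?thesis using imin[of g] by auto
      qed
      then have "{g. g < length P \<and> E v (P ! g)} = (if E v p then {i} else {}) \<union> N v"
        using ilen(1) unfolding N_def p_def by auto
      moreover have "i \<notin> N v" by (simp add: N_def)
      ultimately show ?thesis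
        using deg_in_set_conv_nth[OF P(1)] finN by simp
    qed
    have "Max ((\<lambda>u. card (N u)) ` C) \<in> (\<lambda>u. card (N u)) ` C"
      using finC C(2) by (intro Max_in) auto
    then obtain v where "v \<in> C" "card (N v) = Max ((\<lambda>u. card (N u)) ` C)" by auto
    with finC have v: "v \<in> C" "\<And>u. u \<in> C \<Longrightarrow> card (N u) \<le> card (N v)"
      by simp_all
    obtain d where d: "d \<in> C" "E d q" using h(1) by (auto simp: A_def q_def)
    then have "h \<in> N d" using ilen by (auto simp: N_def q_def)
    then have "0 < card (N d)" using finN card_gt_0_iff by blast
    then have Nv: "0 < card (N v)" using v(2)[OF d(1)] by simp
    \<comment> \<open>Of its neighbours beyond \<open>p\<close>, a vertex keeps one after the
      identification, so it loses at most \<open>M\<close>.\<close>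
    define M where "M = card (N v) - 1"
    let ?E = "merged E C S p q"
    have "weight E C (set P) \<le> weight ?E C {p, q} + 2 * M * card C"
    proof (rule merged_weight[OF pS(4,5,3) finC])
      fix u assume u: "u \<in> C"
      have "card (N u) \<le> of_bool (N u \<noteq> {}) + M" using v(2)[OF u] by (auto simp: M_def)
      then show "deg_in E (set P) u \<le> of_bool (E u p) + of_bool (\<exists>s\<in>S. E u s) + M"
        using degP[OF u] N_iff[OF u] by simp
    qed
    moreover
    have "2 * card (N v) \<le> Suc (length P) - Suc i"
    proof (rule card_spaced_le)
      show "N v \<subseteq> {Suc i..<length P}" by (auto simp: N_def)
      show "Suc g \<notin> N v" if "g \<in> N v" for g
      proof
        assume "Suc g \<in> N v"
        then have "length [v] + 1 \<le> Suc g - g"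
          using that v CD(3) sym by (intro detour_gap[OF lP]) (auto simp: N_def spath_def)
        then show False by simp
      qed
    qed
    \<comment> \<open>The bound makes \<open>t - 2 * M\<close> an untruncated difference: lowering
      the target by \<open>2 * M\<close> pays exactly for the lost weight.\<close>
    then have M2: "2 * M \<le> t" using short by (simp add: M_def)
    then have "card C * Suc t = card C * Suc (t - 2 * M) + 2 * M * card C"
      by (simp flip: add_mult_distrib2 add: mult.commute[of "2 * M"])
    ultimately have rich: "card C * Suc (t - 2 * M) < weight ?E C {p, q}"
      using C(4) by linarith
    have "two_attached ?E C {p, q}"
      unfolding S_def
    proof (rule merged_two_attached[OF att C(3) CD(2) pS(1)])
      show "\<exists>d\<in>C. E d p" using iA by (auto simp: A_def p_def)
      show "\<exists>d\<in>C. \<exists>s\<in>set P - {p}. E d s" using d pS by blast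
    qed (use pS in auto)
    moreover have "?E p q" by (simp add: merged_def)
    ultimately obtain Q where Q: "spath ?E Q" "set Q \<subseteq> C \<union> {p, q}" "hd Q = p" "last Q = q"
      "3 \<le> length Q" "t - 2 * M < length Q"
      using less.hyps[OF cC merged_sym_rel[OF pS(4,5,3)] finC pS(4,5,3) _ _ rich] by blast
    obtain R where R: "Q = p # R @ [q]" "R \<noteq> []"
    proof -
      obtain Q' where Q': "Q = p # Q'" using Q(3,5) by (cases Q) auto
      moreover obtain R where "Q' = R @ [q]" using Q' Q(4,5) by (cases Q' rule: rev_cases) auto
      ultimately show thesis using that Q(5) by (cases R) auto
    qed
    have RC: "set R \<subseteq> C" using Q(1,2) R by (auto simp: spath_def)
    have "successively ?E R" using Q(1) R by (auto simp: spath_def successively_Cons successively_append_iff)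
    then have "successively E R"
      by (rule successively_mono) (use RC pS(4,5) in \<open>auto simp: merged_def\<close>)
    then have Rp: "spath E R" using Q(1) R by (auto simp: spath_def)
    have hl: "hd R \<in> C" "last R \<in> C" using R(2) RC by auto
    have "?E p (hd R)" "?E (last R) q"
      using Q(1) R by (auto simp: spath_def successively_Cons successively_append_iff)
    then have ends: "E p (hd R)" "\<exists>s\<in>S. E (last R) s"
      using hl pS sym by (auto simp: merged_def)
    \<comment> \<open>Back in \<open>E\<close>, the last edge of \<open>Q\<close> leads to some
      vertex of \<open>S\<close>, which lies after \<open>p\<close> on \<open>P\<close>; thus
      \<open>R\<close> is a detour of \<open>P\<close>.\<close>
    from ends(2) N_iff[OF hl(2)] obtain j where j: "i < j" "j < length P" "E (last R) (P ! j)"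
      by (auto simp: N_def)
    \<comment> \<open>The left side is \<open>length Q + 2 * M\<close>, as
      \<open>card (N v) = M + 1\<close>; this exceeds \<open>t\<close>, whereas
      \<open>length P \<le> t\<close>.\<close>
    have "length R + 2 * card (N v) \<le> length P - i"
      using ends(1) by (intro detour_and_neighbours[OF lP CD(3) C(3) j(1,2) Rp R(2) RC _ j(3) v(1)])
        (auto simp: N_def p_def)
    moreover have "length Q = length R + 2" using R by simp
    ultimately show False using Q(6) short Nv M2 by (auto simp: M_def)
  qed
  then show ?case using lP hdP P3 by (auto simp: longest_path_in_def)
qed


section \<open>Spiders along a longest cycle\<close>

text \<open>A vertex \<open>w\<close> outside \<open>V\<close> gives the connectivity of
  \<open>V\<close> itself. No lower bound on the size of \<open>V\<close> is built in.\<close>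

definition two_conn_set :: "('a \<Rightarrow> 'a \<Rightarrow> bool) \<Rightarrow> 'a set \<Rightarrow> bool" where
  "two_conn_set E V \<longleftrightarrow> (\<forall>w. conn_set E (V - {w}))"

text \<open>The closing edge is implicit, so \<open>length C\<close> is the number of edges of the
  cycle.\<close>

definition rooted_cycle :: "('a \<Rightarrow> 'a \<Rightarrow> bool) \<Rightarrow> 'a set \<Rightarrow> 'a \<Rightarrow> 'a list \<Rightarrow> bool" where
  "rooted_cycle E V r C \<longleftrightarrow>
     spath E C \<and> set C \<subseteq> V \<and> hd C = r \<and> E (last C) r \<and> 3 \<le> length C"

text \<open>The lists omit the root, so their lengths are the lengths of the legs.\<close>

definition three_legs :: "('a \<Rightarrow> 'a \<Rightarrow> bool) \<Rightarrow> 'a set \<Rightarrow> 'a \<Rightarrow> 'a list \<Rightarrow> 'a list \<Rightarrow> 'a list \<Rightarrow> bool" where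
  "three_legs E V r A B C \<longleftrightarrow> distinct (r # A @ B @ C) \<and> set (r # A @ B @ C) \<subseteq> V \<and>
     successively E (r # A) \<and> successively E (r # B) \<and> successively E (r # C)"

lemma conn_setD:
  assumes "conn_set E X" "U \<subseteq> X" "a \<in> U" "b \<in> X - U"
  shows "\<exists>u\<in>U. \<exists>w\<in>X - U. E u w"
  using assms(1)[unfolded conn_set_def, rule_format, of U "X - U"] assms(2-4) by blast

text \<open>Deleting \<open>y\<close> leaves an edge from \<open>U\<close> to some \<open>p\<close>,
  and deleting \<open>p\<close> one to some \<open>q\<close>. The other side of the cut still
  contains \<open>x\<close> in the first case and \<open>y\<close> in the second.\<close>

lemma two_conn_set_two_attached:
  assumes "two_conn_set E (D \<union> {x, y})" "x \<notin> D" "y \<notin> D" "x \<noteq> y"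
  shows "two_attached E D {x, y}"
  unfolding two_attached_def
proof (intro allI impI)
  fix U assume U: "U \<subseteq> D" "U \<noteq> {}"
  let ?V = "D \<union> {x, y}"
  have c: "conn_set E (?V - {w})" for w using assms(1) by (simp add: two_conn_set_def)
  obtain a where a: "a \<in> U" using U by blast
  have "\<exists>u\<in>U. \<exists>p\<in>?V - {y} - U. E u p"
    by (rule conn_setD[OF c _ a, of y x]) (use U assms in auto)
  then obtain u p where p: "u \<in> U" "p \<in> ?V - {y} - U" "E u p" by blast
  have "\<exists>u\<in>U. \<exists>q\<in>?V - {p} - U. E u q"
    by (rule conn_setD[OF c _ a, of p y]) (use U assms p in auto)
  then obtain u' q where q: "u' \<in> U" "q \<in> ?V - {p} - U" "E u' q" by blast
  show "\<exists>p\<in>?V - U. \<exists>q\<in>?V - U. p \<noteq> q \<and> (\<exists>u\<in>U. E u p) \<and> (\<exists>u\<in>U. E u q)"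
    using p q by (intro bexI[of _ p] bexI[of _ q]) auto
qed

section \<open>Cycles through a root and legs along them\<close>

context sym_rel
begin

lemma successively_rev_iff: "successively E (rev xs) \<longleftrightarrow> successively E xs"
  unfolding successively_rev conversep_eq ..

lemma spath_take: "spath E xs \<Longrightarrow> spath E (take n xs)"
  using append_take_drop_id[of n xs] unfolding spath_def
  by (metis distinct_take successively_append_iff)

lemma spath_drop: "spath E xs \<Longrightarrow> spath E (drop n xs)"
  using append_take_drop_id[of n xs] unfolding spath_def
  by (metis distinct_drop successively_append_iff)

text \<open>A cycle minus a vertex \<open>w\<close> is a path, as rotating the list at
  \<open>w\<close> shows.\<close>

lemma cycle_crossing:
  assumes C: "rooted_cycle E V r C"
    and ab: "a \<in> set C" "a \<in> U" "a \<noteq> w" "b \<in> set C" "b \<notin> U" "b \<noteq> w"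
  shows "\<exists>u\<in>set C \<inter> U - {w}. \<exists>v\<in>set C - U - {w}. E u v"
proof -
  obtain xs where xs: "set xs = set C - {w}" "successively E xs"
  proof (cases "w \<in> set C")
    case False
    with C that[of C] show thesis by (auto simp: rooted_cycle_def spath_def)
  next
    case True
    then obtain ys zs where C': "C = ys @ w # zs" by (meson split_list)
    have "set (zs @ ys) = set C - {w}"
      using C C' by (auto simp: rooted_cycle_def spath_def)
    moreover have "successively E (zs @ ys)"
      using C C' by (cases "zs = []"; cases "ys = []")
        (auto simp: rooted_cycle_def spath_def successively_append_iff successively_Cons)
    ultimately show thesis using that by blast
  qed
  then show ?thesis
    using successively_crossing[OF xs(2), of a U b] ab by (metis Diff_iff IntI singletonD singletonI)
qed

text \<open>A side of a cut that avoids the cycle has an edge leaving it in \<open>V - {w}\<close>,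
  and this edge cannot end in \<open>D\<close>, which has no outer neighbours off the cycle. If both
  sides meet the cycle, the cycle minus \<open>w\<close> crosses the cut.\<close>

lemma two_conn_set_minus_component:
  assumes V: "two_conn_set E V" and C: "rooted_cycle E V r C" and D: "D \<subseteq> V - set C"
    and cl: "\<And>d v. d \<in> D \<Longrightarrow> v \<in> V - set C - D \<Longrightarrow> \<not> E d v"
  shows "two_conn_set E (V - D)"
  unfolding two_conn_set_def
proof
  fix w
  have off: "\<exists>u\<in>U. \<exists>v\<in>W. E u v"
    if UW: "U \<union> W = V - D - {w}" "U \<inter> W = {}" "U \<noteq> {}" "W \<noteq> {}" "U \<inter> set C = {}" for U W
  proof -
    obtain a b where "a \<in> U" "b \<in> W" using UW by blast
    moreover have "conn_set E (V - {w})" using V by (simp add: two_conn_set_def)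
    ultimately obtain u v where uv: "u \<in> U" "v \<in> V - {w} - U" "E u v"
      using conn_setD[of E "V - {w}" U a b] UW by blast
    have "v \<notin> D"
    proof
      assume "v \<in> D"
      moreover have "u \<in> V - set C - D" using UW uv(1) by blast
      ultimately show False using cl sym[OF uv(3)] by blast
    qed
    then have "v \<in> W" using uv(2) UW by blast
    with uv show ?thesis by blast
  qed
  show "conn_set E (V - D - {w})"
    unfolding conn_set_def
  proof (intro allI impI, elim conjE)
    fix U W assume UW: "U \<union> W = V - D - {w}" "U \<inter> W = {}" "U \<noteq> {}" "W \<noteq> {}"
    consider "U \<inter> set C = {}" | "W \<inter> set C = {}" | a b where "a \<in> U \<inter> set C" "b \<in> W \<inter> set C"
      by (metis ex_in_conv)
    then show "\<exists>u\<in>U. \<exists>v\<in>W. E u v"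
    proof cases
      case 1
      then show ?thesis by (intro off UW)
    next
      case 2
      have "\<exists>u\<in>W. \<exists>v\<in>U. E u v" by (rule off) (use 2 UW in auto)
      with sym show ?thesis by blast
    next
      case (3 a b)
      then have "\<exists>u\<in>set C \<inter> U - {w}. \<exists>v\<in>set C - U - {w}. E u v"
        using UW by (intro cycle_crossing[OF C, of a U w b]) auto
      moreover have "set C - U - {w} \<subseteq> W" using UW C D by (auto simp: rooted_cycle_def)
      ultimately show ?thesis by blast
    qed
  qed
qed

text \<open>Removing \<open>z\<close> from a smallest subset that is too heavy lowers the weight by
  more than \<open>m\<close>, and by at most twice the degree of \<open>z\<close> into
  \<open>S\<close> and \<open>P\<close>.\<close>

lemma rich_subset:
  assumes "finite D" "finite P" "card D * m < weight E D P" "D \<inter> P = {}"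
  obtains S where "S \<subseteq> D" "S \<noteq> {}" "\<And>z. z \<in> S \<Longrightarrow> m < 2 * (deg_in E S z + deg_in E P z)"
proof -
  let ?Q = "\<lambda>S. S \<subseteq> D \<and> card S * m < weight E S P"
  obtain S where S: "?Q S" "\<forall>S'. ?Q S' \<longrightarrow> card S \<le> card S'"
    using ex_has_least_nat[of ?Q D card] assms(3) by auto
  have fin: "finite S" using S(1) assms(1) finite_subset by blast
  have "m < 2 * (deg_in E S z + deg_in E P z)" if z: "z \<in> S" for z
  proof -
    obtain T where T: "S = {z} \<union> T" "z \<notin> T"
      using z by (metis insert_is_Un mk_disjoint_insert)
    have f: "finite {z}" "finite T" "{z} \<inter> T = {}" using T fin by auto
    have cS: "card S = Suc (card T)" using T f by simp
    then have "\<not> ?Q T" using S(2)[rule_format, of T] by auto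
    then have "weight E T P \<le> card T * m" using S(1) T(1) by auto
    moreover have "card S * m = card T * m + m" using cS by simp
    moreover have "weight E S P = weight E {z} P + weight E T P + 2 * pairs E {z} T"
      unfolding T(1) weight_def pairs_Un_self[OF f] unfolding pairs_Un_left[OF f]
      by (simp only: algebra_simps)
    moreover have "weight E {z} P = 2 * deg_in E P z"
      using irrefl by (simp add: weight_def pairs_def deg_in_def)
    moreover have "pairs E {z} T \<le> deg_in E S z"
      using fin T(1) by (simp add: pairs_def deg_in_mono subset_insertI)
    ultimately show ?thesis using conjunct2[OF S(1)] by simp
  qed
  moreover have "S \<noteq> {}" using S(1) by auto
  ultimately show thesis using that S(1) by blast
qed

text \<open>The \<open>length C - 1\<close> vertices of the cycle other than \<open>r\<close>
  suffice for two legs in opposite directions; \<open>Y\<close> provides the third.\<close>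

lemma legs_from_cycle:
  assumes C: "rooted_cycle E V r C" and Y: "spath E Y" "Y \<noteq> []" "set Y \<subseteq> V - set C" "E r (hd Y)"
    and len: "a + b < length C" "c \<le> length Y"
  shows "\<exists>X Y Z. length X = a \<and> length Y = b \<and> length Z = c \<and> three_legs E V r X Y Z"
proof -
  obtain Q where Q: "C = r # Q" using C by (cases C) (auto simp: rooted_cycle_def)
  let ?X = "take a Q" and ?M = "take (length Q - a - b) (drop a Q)" and ?B = "drop (length Q - b) Q"
  have Q': "Q = ?X @ ?M @ ?B"
  proof -
    have "drop (length Q - b) Q = drop (length Q - a - b) (drop a Q)"
      using len Q by (simp add: add.commute)
    then show ?thesis by (metis append_take_drop_id)
  qed
  obtain X M B where XMB: "C = r # X @ M @ B" "length X = a" "length B = b"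
  proof
    show "C = r # ?X @ ?M @ ?B" using Q Q' by simp
  qed (use len Q in auto)
  have "three_legs E V r X (rev B) (take c Y)"
  proof -
    have "set (take c Y) \<subseteq> set Y" by (rule set_take_subset)
    moreover have "distinct (take c Y)" "successively E (take c Y)"
      using spath_take[OF Y(1)] by (auto simp: spath_def)
    moreover have "successively E (r # take c Y)"
    proof (cases "take c Y = []")
      case False
      then have "hd (take c Y) = hd Y" using hd_take by (metis take_eq_Nil gr0I)
      with False Y(4) \<open>successively E (take c Y)\<close> show ?thesis by (simp add: successively_Cons)
    qed (simp only: successively.simps)
    moreover have "successively E (r # rev B)"
    proof (cases "B = []")
      case False
      then have "E (last B) r" "successively E B"
        using C XMB(1) by (auto simp: rooted_cycle_def spath_def successively_append_iff successively_Cons)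
      with False sym successively_rev_iff[of B] show ?thesis
        by (simp add: successively_Cons hd_rev del: successively_rev)
    qed simp
    moreover have "successively E (r # X)"
      using C XMB(1) by (cases X) (auto simp: rooted_cycle_def spath_def successively_append_iff successively_Cons)
    ultimately show ?thesis
      using C XMB(1) Y(3) by (auto simp: three_legs_def rooted_cycle_def spath_def)
  qed
  then show ?thesis using XMB len by (intro exI conjI) (auto simp: min_def)
qed

text \<open>
  With \<open>Y = []\<close>, a chord from \<open>r\<close> to \<open>C ! j\<close>; otherwise a path from \<open>r\<close> to \<open>C ! j\<close> through \<open>Y\<close>.
  The first leg follows it and then goes on along the cycle, away from the other two.
\<close>

lemma legs_from_chord:
  assumes C: "rooted_cycle E V r C" and Y: "spath E (r # Y)" "set Y \<subseteq> V - set C"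
    and j: "E (last (r # Y)) (C ! j)" "c < j" "j + a + b \<le> length C + length Y"
    and len: "length Y < a" "0 < b"
  shows "\<exists>X Y Z. length X = a \<and> length Y = b \<and> length Z = c \<and> three_legs E V r X Y Z"
proof -
  let ?L = "length C" and ?x = "length Y"
  obtain Q where Q: "C = r # Q" using C by (cases C) (auto simp: rooted_cycle_def)
  have jL: "j < ?L" using j(3) len by linarith
  \<comment> \<open>Beyond \<open>r\<close>, the cycle is cut into
    \<open>Z @ M @ A @ M' @ B\<close>. \<open>Z\<close> is the leg of length \<open>c\<close>,
    \<open>A\<close> starts at \<open>C ! j\<close> and completes \<open>Y\<close> to length
    \<open>a\<close>, and \<open>B\<close> read backwards is the leg of length
    \<open>b\<close>.\<close>
  define Z where "Z = take c Q"
  define M where "M = take (j - Suc c) (drop c Q)"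
  define Q2 where "Q2 = drop (j - Suc c) (drop c Q)"
  define A where "A = take (a - ?x) Q2"
  define Q3 where "Q3 = drop (a - ?x) Q2"
  define M' where "M' = take (length Q3 - b) Q3"
  define B where "B = drop (length Q3 - b) Q3"
  have C': "C = r # Z @ M @ A @ M' @ B"
    by (simp add: Q Z_def M_def Q2_def A_def Q3_def M'_def B_def del: drop_drop)
  have lens: "length Z = c" "length M = j - Suc c" "length Q2 = ?L - j"
    using jL j(2) by (auto simp: Z_def M_def Q2_def Q)
  then have lens': "length A = a - ?x" "length Q3 = ?L - j - (a - ?x)"
    using j(3) len by (auto simp: A_def Q3_def)
  then have lB: "length B = b" using j(3) len by (auto simp: B_def)
  have "A \<noteq> []" "B \<noteq> []" using lens' lB len by auto
  have "C ! j = hd A"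
  proof -
    have "C = (r # Z @ M) @ (A @ M' @ B)" using C' by simp
    moreover have "length (r # Z @ M) = j" using lens j(2) by simp
    ultimately have "C ! j = (A @ M' @ B) ! 0" by (metis add.right_neutral nth_append_length_plus)
    then show ?thesis using \<open>A \<noteq> []\<close> by (simp add: hd_conv_nth nth_append)
  qed
  have d: "distinct C" "set C \<subseteq> V" "successively E C" "E (last C) r"
    using C by (auto simp: rooted_cycle_def spath_def)
  have "successively E (Z @ M @ A @ M' @ B)" using d(3) unfolding C' successively_Cons by (elim disjE conjE) simp_all
  then have s: "successively E Z" "successively E A" "successively E B"
    by (auto simp: successively_append_iff)
  have "successively E (r # Z)"
    using d(3) C' s(1) by (cases Z) (auto simp: successively_Cons)
  moreover have "successively E (r # rev B)"
    using s(3) d(4) sym \<open>B \<noteq> []\<close> C' successively_rev_iff[of B]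
    by (simp add: successively_Cons hd_rev del: successively_rev)
  moreover have "successively E ((r # Y) @ A)"
    using Y(1) s(2) j(1) \<open>C ! j = hd A\<close> unfolding spath_def by (subst successively_append_iff) simp
  ultimately have "three_legs E V r (Y @ A) (rev B) Z"
    using d(1,2) C' Y by (auto simp: three_legs_def spath_def)
  then show ?thesis using lens lens' lB len by (intro exI conjI) auto
qed


text \<open>A long path from \<open>r\<close> to a neighbour \<open>x\<close> is closed by the edge
  between them.\<close>

lemma long_cycle_through:
  assumes V: "finite V" "two_conn_set E V" "card V * m < pairs E V V" and r: "r \<in> V" "0 < deg_in E V r"
    and t: "Suc t \<le> m"
  obtains C where "rooted_cycle E V r C" "t < length C"
proof -
  obtain x where x: "x \<in> V" "E r x" using r(2) by (auto simp: deg_in_def card_gt_0_iff)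
  have rx: "r \<noteq> x" using x irrefl by auto
  let ?D = "V - {r, x}"
  have VD: "?D \<union> {r, x} = V" using x r by auto
  have f: "finite ?D" "finite {r, x}" "?D \<inter> {r, x} = {}" using V(1) by auto
  have "pairs E V V = weight E ?D {r, x} + pairs E {r, x} {r, x}"
    using pairs_Un_self[OF f] unfolding VD weight_def by linarith
  \<comment> \<open>This loss is covered by the two vertices left out, which lower the required
    weight by \<open>2 * m \<ge> 2\<close>.\<close>
  moreover have "pairs E {r, x} {r, x} \<le> 2" using pairs_self_le[of "{r, x}"] rx by simp
  moreover have "card V = card ?D + 2"
    using card_Un_disjoint[OF f] rx unfolding VD by simp
  ultimately have "card ?D * m < weight E ?D {r, x}"
    using V(3) t by (simp add: add_mult_distrib)
  then have "card ?D * Suc t < weight E ?D {r, x}"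
    using t mult_le_mono2[of "Suc t" m "card ?D"] by linarith
  then obtain P where P: "spath E P" "set P \<subseteq> V" "hd P = r" "last P = x" "3 \<le> length P" "t < length P"
    using long_path_between[OF sym_rel_axioms f(1) _ _ rx x(2)]
      two_conn_set_two_attached[of E ?D r x] V(2) rx unfolding VD by blast
  then have "rooted_cycle E V r P" using x sym by (auto simp: rooted_cycle_def)
  with P that show thesis by blast
qed

section \<open>Neighbours on and off a longest cycle\<close>

lemma longest_cycle_exists:
  assumes "finite V" "rooted_cycle E V r C0"
  obtains C where "rooted_cycle E V r C" "length C0 \<le> length C"
    "\<And>C'. rooted_cycle E V r C' \<Longrightarrow> length C' \<le> length C"
proof -
  have "\<forall>C. rooted_cycle E V r C \<longrightarrow> length C < Suc (card V)"
    using assms(1) unfolding rooted_cycle_def spath_def less_Suc_eq_le by (metis card_mono distinct_card)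
  then have "\<exists>C. rooted_cycle E V r C \<and> (\<forall>C'. rooted_cycle E V r C' \<longrightarrow> length C' \<le> length C)"
    using ex_has_greatest_nat[of "rooted_cycle E V r" C0 length "Suc (card V)"] assms(2) by blast
  then obtain C where C: "rooted_cycle E V r C" "\<forall>C'. rooted_cycle E V r C' \<longrightarrow> length C' \<le> length C"
    by (elim exE conjE)
  then show thesis using that assms(2) by blast
qed

text \<open>
  \<open>z\<close> is the end of a path \<open>Y\<close> starting next to \<open>r\<close> and avoiding the longest cycle. Maximality keeps
  the neighbours of \<open>z\<close> on the cycle apart and away from \<open>r\<close>; the absence of the legs keeps them
  out of an interval. This leaves too few positions.
\<close>

lemma few_neighbours_on_cycle:
  assumes C: "rooted_cycle E V r C" and mx: "\<And>C'. rooted_cycle E V r C' \<Longrightarrow> length C' \<le> length C"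
    and Y: "spath E Y" "Y \<noteq> []" "set Y \<subseteq> V - set C" "E r (hd Y)" and z: "z = last Y"
    and len: "length Y < c" "c \<le> a" "c \<le> b" "a + b < length C"
    and no: "\<not> (\<exists>X Y Z. length X = a \<and> length Y = b \<and> length Z = c \<and> three_legs E V r X Y Z)"
  shows "2 * deg_in E (set C) z + 3 * length Y \<le> a + b + c + 3"
proof -
  let ?L = "length C" and ?x = "length Y"
  obtain n where x: "?x = Suc n" using Y(2) by (cases Y) auto
  have ne: "C \<noteq> []" using C by (auto simp: rooted_cycle_def)
  have Cp: "spath E C" "distinct C" "set C \<subseteq> V" "hd C = r" "E (last C) r" "C \<noteq> []" "C ! 0 = r"
    using C ne hd_conv_nth[OF ne] by (auto simp: rooted_cycle_def spath_def)
  have "z \<in> set Y" using Y(2) z by simp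
  then have zY: "z \<in> set Y" "z \<notin> set C" "z \<in> V" using Y(3) by auto
  have rY: "spath E (r # Y)" "set Y \<inter> set C = {}"
    using Y Cp(4,6) by (auto simp: spath_def successively_Cons)
  define N where "N = {j. 0 < j \<and> j < ?L \<and> E z (C ! j)}"
  have "{j. j < ?L \<and> E z (C ! j)} \<subseteq> insert 0 N" by (auto simp: N_def)
  then have "deg_in E (set C) z \<le> card (insert 0 N)"
    unfolding deg_in_set_conv_nth[OF Cp(2)] by (rule card_mono[rotated]) (auto simp: N_def)
  \<comment> \<open>The added one stands for position 0, the root, which \<open>N\<close> leaves
    out.\<close>
  then have degz: "deg_in E (set C) z \<le> Suc (card N)" by (simp add: N_def)
  \<comment> \<open>\<open>Y\<close> may replace the stretch of the cycle between \<open>r\<close>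
    and \<open>C ! j\<close>; \<open>hi\<close> does the same with the stretch from
    \<open>C ! j\<close> back to \<open>r\<close>.\<close>
  have lo: "?x < j" if "j \<in> N" for j
  proof -
    have j: "0 < j" "j < ?L" "E z (C ! j)" using that by (auto simp: N_def)
    have "r \<notin> set (drop j C)"
      using Cp(2,4,6) j(1) by (cases C; cases j) (auto dest: in_set_dropD)
    moreover have "spath E (drop j C)" using Cp(1) by (rule spath_drop)
    moreover have "set (drop j C) \<subseteq> set C" by (rule set_drop_subset)
    ultimately have "spath E ((r # Y) @ drop j C)"
      using rY j z Y(2) by (subst spath_append) (auto simp: hd_drop_conv_nth)
    then have "rooted_cycle E V r ((r # Y) @ drop j C)"
      using Cp Y(3) j x set_drop_subset[of j C] by (auto simp: rooted_cycle_def)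
    from mx[OF this] j show ?thesis by simp
  qed
  have hi: "j < ?L - ?x" if "j \<in> N" for j
  proof -
    have j: "0 < j" "j < ?L" "E z (C ! j)" using that by (auto simp: N_def)
    have "spath E (take (Suc j) C)" using Cp(1) by (rule spath_take)
    moreover have "set (take (Suc j) C) \<subseteq> set C" by (rule set_take_subset)
    moreover have "last (take (Suc j) C) = C ! j" using j by (simp add: take_Suc_conv_app_nth)
    ultimately have "spath E (take (Suc j) C @ rev Y)"
      using rY(2) Y(1,2) Cp(6) j sym z by (subst spath_append) (auto simp: hd_rev)
    then have "rooted_cycle E V r (take (Suc j) C @ rev Y)"
      using Cp Y j x sym set_take_subset[of "Suc j" C] by (auto simp: rooted_cycle_def last_rev)
    from mx[OF this] j show ?thesis by simp
  qed
  \<comment> \<open>Otherwise \<open>z\<close> could be inserted between two consecutive vertices of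
    the cycle.\<close>
  have spaced: "Suc j \<notin> N" if "j \<in> N" for j
  proof
    assume "Suc j \<in> N"
    then have j: "0 < j" "Suc j < ?L" "E z (C ! j)" "E z (C ! Suc j)" using that by (auto simp: N_def)
    have t: "spath E (take (Suc j) C)" "spath E (drop (Suc j) C)"
      using Cp(1) by (auto intro: spath_take spath_drop)
    have sub: "set (take (Suc j) C) \<subseteq> set C" "set (drop (Suc j) C) \<subseteq> set C"
      by (rule set_take_subset, rule set_drop_subset)
    have "spath E ([z] @ drop (Suc j) C)"
      using t sub zY(2) j by (subst spath_append) (auto simp: hd_drop_conv_nth spath_def)
    moreover have "set (take (Suc j) C) \<inter> set (drop (Suc j) C) = {}"
      using Cp(2) by (rule set_take_disj_set_drop_if_distinct) simp
    moreover have "last (take (Suc j) C) = C ! j" using j by (simp add: take_Suc_conv_app_nth)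
    ultimately have "spath E (take (Suc j) C @ [z] @ drop (Suc j) C)"
      using t sub zY(2) j Cp(6) sym by (subst spath_append) auto
    then have "rooted_cycle E V r (take (Suc j) C @ [z] @ drop (Suc j) C)"
      using Cp zY(3) j sub by (auto simp: rooted_cycle_def)
    from mx[OF this] j show False by simp
  qed
  have gap: "?L + ?x < j + a + b" if "j \<in> N" "c < j" for j
  proof (rule ccontr)
    assume "\<not> ?thesis"
    then show False
      using that no len legs_from_chord[OF C rY(1) Y(3), of j c a b] Y(2) z
      by (auto simp: N_def)
  qed
  have finN: "finite N" by (simp add: N_def)
  \<comment> \<open>The bound here is \<open>c + 1 - ?x\<close>, the next one
    \<open>a + b - 2 * ?x\<close>. With 2 for the root, they add up to
    \<open>a + b + c + 3 - 3 * ?x\<close>.\<close>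
  have "2 * card (N \<inter> {..c}) \<le> Suc (Suc c) - Suc ?x"
    using lo spaced by (intro card_spaced_le) (auto simp: Suc_le_eq less_Suc_eq_le)
  moreover have "2 * card (N \<inter> {c<..}) \<le> Suc (?L - ?x) - (?L + ?x + 1 - (a + b))"
  proof (rule card_spaced_le)
    show "N \<inter> {c<..} \<subseteq> {?L + ?x + 1 - (a + b)..<?L - ?x}"
      using gap hi by fastforce
  qed (use spaced in auto)
  moreover have "card N = card (N \<inter> {..c}) + card (N \<inter> {c<..})"
    using finN by (subst card_Un_disjoint[symmetric]) (auto intro: arg_cong[where f = card])
  ultimately show ?thesis using degz len by linarith
qed

text \<open>A chord from \<open>r\<close> to a position \<open>j\<close> with
  \<open>c < j \<le> length C - a - b\<close> would give the legs. This leaves \<open>c\<close>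
  positions at the start of the cycle and \<open>a + b - 1\<close> at its end, fewer than the degree
  of \<open>r\<close>.\<close>

lemma neighbour_off_cycle:
  assumes V: "finite V" and C: "rooted_cycle E V r C" and len: "a + b < length C" "0 < a" "0 < b"
    and deg: "a + b + c \<le> deg_in E V r"
    and no: "\<not> (\<exists>X Y Z. length X = a \<and> length Y = b \<and> length Z = c \<and> three_legs E V r X Y Z)"
  obtains w where "w \<in> V - set C" "E r w"
proof -
  have "\<exists>w\<in>V - set C. E r w"
  proof (rule ccontr)
    assume on: "\<not> ?thesis"
    have ne: "C \<noteq> []" using C by (auto simp: rooted_cycle_def)
    have Cp: "distinct C" "set C \<subseteq> V" "hd C = r" "C \<noteq> []" "C ! 0 = r"
      using C ne hd_conv_nth[OF ne] by (auto simp: rooted_cycle_def spath_def)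
    have "{u \<in> V. E r u} = {u \<in> set C. E r u}" using on Cp(2) by blast
    then have "deg_in E V r = deg_in E (set C) r" by (simp add: deg_in_def)
    moreover have "{j. j < length C \<and> E r (C ! j)} \<subseteq> {1..c} \<union> {length C - (a + b) <..<length C}"
    proof
      fix j assume "j \<in> {j. j < length C \<and> E r (C ! j)}"
      then have j: "j < length C" "E r (C ! j)" by auto
      have "j \<noteq> 0" using j(2) Cp(5) irrefl by metis
      moreover have "\<not> (c < j \<and> j + a + b \<le> length C)"
        using no j len legs_from_chord[OF C, of "[]" j c a b] by (auto simp: spath_def)
      ultimately show "j \<in> {1..c} \<union> {length C - (a + b) <..<length C}" using j(1) by auto
    qed
    then have "deg_in E (set C) r \<le> card ({1..c} \<union> {length C - (a + b) <..<length C})"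
      unfolding deg_in_set_conv_nth[OF Cp(1)] by (intro card_mono) auto
    also have "\<dots> \<le> card {1..c} + card {length C - (a + b) <..<length C}" by (rule card_Un_le)
    also have "\<dots> < a + b + c" using len by simp
    finally show False using deg \<open>deg_in E V r = _\<close> by simp
  qed
  with that show thesis by blast
qed

text \<open>The root is not fixed in advance, because the induction chooses a new one after a sparse
  component is deleted. The degree bound is carried along to provide the leg of length 1.\<close>

lemma spider_in_two_conn_set:
  assumes "finite V" "two_conn_set E V" "card V * (a + b + c) < pairs E V V"
    and abc: "0 < c" "c \<le> a" "c \<le> b"
  shows "\<exists>r X Y Z. length X = a \<and> length Y = b \<and> length Z = c \<and> three_legs E V r X Y Z \<and>
    a + b + c < deg_in E V r"
  using assms(1-3)
proof (induction "card V" arbitrary: V rule: less_induct)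
  case less
  let ?m = "a + b + c"
  note V = less.prems
  obtain r where r: "r \<in> V" "?m < deg_in E V r"
  proof -
    have "\<not> (\<forall>v\<in>V. deg_in E V v \<le> ?m)"
      using sum_bounded_above[of V "deg_in E V" ?m] V(3) by (auto simp: pairs_def)
    with that show thesis by (auto simp: not_le)
  qed
  have rpos: "0 < deg_in E V r" using r(2) by simp
  obtain C0 where C0: "rooted_cycle E V r C0" "a + b < length C0"
    using long_cycle_through[OF V r(1) rpos, of "a + b"] abc by auto
  obtain C where C: "rooted_cycle E V r C" "length C0 \<le> length C"
    and mx: "\<And>C'. rooted_cycle E V r C' \<Longrightarrow> length C' \<le> length C"
    using longest_cycle_exists[OF V(1) C0(1)] by blast
  have L: "a + b < length C" using C0 C by simp
  have finC: "finite (set C)" "set C \<subseteq> V" using C by (auto simp: rooted_cycle_def)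
  show ?case
  proof (rule ccontr)
    assume neg: "\<not> ?thesis"
    then have no: "\<not> (\<exists>X Y Z. length X = a \<and> length Y = b \<and> length Z = c \<and> three_legs E V r X Y Z)"
      using r(2) by blast
    obtain w where w: "w \<in> V - set C" "E r w"
      using neighbour_off_cycle[OF V(1) C(1) L _ _ _ no] abc r(2) by auto
    obtain D where D: "D \<subseteq> V - set C" "w \<in> D" "conn_set E D"
      "\<And>d v. d \<in> D \<Longrightarrow> v \<in> V - set C - D \<Longrightarrow> \<not> E d v"
      using component_exists[OF finite_Diff[OF V(1)] w(1)] by metis
    have finD: "finite D" using D(1) V(1) finite_subset by blast
    show False
    proof (cases "card D * ?m < weight E D (set C)")
      case False
      \<comment> \<open>Deleting \<open>D\<close> lowers the degree sum by
        \<open>weight E D (set C)\<close>, at most \<open>card D * ?m\<close>, so the density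
        hypothesis survives.\<close>
      let ?V = "V - D"
      have VD: "?V \<union> D = V" "?V \<inter> D = {}" using D(1) by auto
      have fV: "finite ?V" using V(1) by simp
      have "pairs E V V = pairs E ?V ?V + pairs E D D + 2 * pairs E ?V D"
        using pairs_Un_self[OF fV finD VD(2)] unfolding VD(1) .
      moreover have "pairs E ?V D = pairs E D (set C)"
      proof -
        have "?V = set C \<union> (V - set C - D)" using finC D(1) by auto
        moreover have "pairs E D (set C \<union> (V - set C - D)) = pairs E D (set C) + pairs E D (V - set C - D)"
          using V(1) by (intro pairs_Un_right) auto
        moreover have "pairs E D (V - set C - D) = 0" using D(4) by (rule pairs_eq_0)
        ultimately show ?thesis using pairs_commute[OF fV finD] by simp
      qed
      moreover have "card V = card ?V + card D"
        using card_Un_disjoint[OF fV finD VD(2)] unfolding VD(1) .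
      ultimately have "card ?V * ?m < pairs E ?V ?V"
        using False V(3) by (simp add: weight_def add_mult_distrib)
      moreover have "card ?V < card V"
        using V(1) w D by (intro psubset_card_mono) auto
      moreover have "two_conn_set E ?V"
        using two_conn_set_minus_component[OF V(2) C(1) D(1,4)] .
      ultimately obtain r' X Y Z where legs: "length X = a" "length Y = b" "length Z = c"
        "three_legs E ?V r' X Y Z" "?m < deg_in E ?V r'"
        using less.hyps[of ?V] fV by blast
      have "three_legs E V r' X Y Z" using legs(4) by (auto simp: three_legs_def)
      moreover have "?m < deg_in E V r'"
        using legs(5) deg_in_mono[of V ?V E r'] V(1) by (simp add: order_less_le_trans)
      ultimately show False using neg legs by blast
    next
      case True
      then obtain S where S: "S \<subseteq> D" "S \<noteq> {}"
        "\<And>z. z \<in> S \<Longrightarrow> ?m < 2 * (deg_in E S z + deg_in E (set C) z)"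
        using rich_subset[OF finD finC(1) True] D(1) by blast
      have finS: "finite S" using S(1) finD finite_subset by blast
      \<comment> \<open>Only the last vertex has to lie in \<open>S\<close>: \<open>S\<close> need
        not be connected or contain a neighbour of \<open>r\<close>, so the path may use all of
        \<open>D\<close>.\<close>
      let ?Q = "\<lambda>Y. spath E Y \<and> set Y \<subseteq> D \<and> Y \<noteq> [] \<and> E r (hd Y) \<and> last Y \<in> S"
      obtain s where "s \<in> S" using S(2) by blast
      then obtain Y0 where Y0: "?Q Y0"
        using conn_path_between[OF D(3,2), of s] S(1) w(2) by blast
      have "\<forall>Y. ?Q Y \<longrightarrow> length Y < Suc (card D)"
        using finD unfolding spath_def less_Suc_eq_le by (metis card_mono distinct_card)
      then have "\<exists>Y. ?Q Y \<and> (\<forall>Y'. ?Q Y' \<longrightarrow> length Y' \<le> length Y)"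
        using ex_has_greatest_nat[of ?Q Y0 length "Suc (card D)"] Y0 by blast
      then obtain Y where Y: "?Q Y" and mxY: "\<And>Y'. ?Q Y' \<Longrightarrow> length Y' \<le> length Y"
        by blast
      have YC: "set Y \<subseteq> V - set C" using Y D(1) by blast
      have short: "length Y < c"
        using legs_from_cycle[OF C(1) _ _ YC _ L, of c] Y no by (metis not_le)
      define z where "z = last Y"
      have z: "z \<in> S" "z \<in> set Y" using Y by (auto simp: z_def)
      \<comment> \<open>A neighbour of \<open>z\<close> in \<open>S\<close> off \<open>Y\<close>
        would extend \<open>Y\<close>.\<close>
      have "{u \<in> S. E z u} \<subseteq> set Y - {z}"
      proof
        fix u assume u: "u \<in> {u \<in> S. E z u}"
        have "u \<in> set Y"
        proof (rule ccontr)
          assume "u \<notin> set Y"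
          then have "?Q (Y @ [u])"
            using Y u S(1) by (auto simp: spath_def successively_append_iff z_def)
          from mxY[OF this] show False by simp
        qed
        with u irrefl show "u \<in> set Y - {z}" by auto
      qed
      then have "deg_in E S z \<le> card (set Y - {z})"
        unfolding deg_in_def by (rule card_mono[rotated]) simp
      also have "\<dots> = length Y - 1" using Y z by (simp add: spath_def distinct_card)
      finally have "deg_in E S z \<le> length Y - 1" .
      moreover have "2 * deg_in E (set C) z + 3 * length Y \<le> a + b + c + 3"
        using Y by (intro few_neighbours_on_cycle[OF C(1) mx _ _ YC _ z_def short abc(2,3) L no]) auto
      moreover have "0 < length Y" using Y by simp
      \<comment> \<open>Twice the degree of \<open>z\<close> into \<open>S\<close> and the cycle is
        at most \<open>2 * (length Y - 1) + ?m + 3 - 3 * length Y = ?m + 1 - length Y \<le>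
        ?m\<close>, against the choice of \<open>S\<close>.\<close>
      ultimately show False using S(3)[OF z(1)] unfolding add_mult_distrib2 by linarith
    qed
  qed
qed

end


section \<open>Spiders in symmetric digraphs\<close>

text \<open>If no edge crossed the cut, a walk in the symmetric closure of \<open>H\<close> could
  not leave \<open>U\<close>.\<close>

lemma conn_set_if_connected:
  assumes "Digraph_Component.connected H" "parcs (mk_symmetric H) \<subseteq> {(u, v). E u v}"
  shows "conn_set E (verts H)"
  unfolding conn_set_def
proof (intro allI impI, elim conjE, rule ccontr)
  fix U W assume UW: "U \<union> W = verts H" "U \<inter> W = {}" "U \<noteq> {}" "W \<noteq> {}"
    and no: "\<not> (\<exists>u\<in>U. \<exists>w\<in>W. E u w)"
  obtain a b where ab: "a \<in> U" "b \<in> W" using UW by blast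
  then have "a \<rightarrow>\<^sup>*\<^bsub>mk_symmetric H\<^esub> b"
    using assms(1) UW unfolding Digraph_Component.connected_def strongly_connected_def by auto
  then have "(a, b) \<in> rtrancl_on (verts H) (parcs (mk_symmetric H))"
    by (simp add: reachable_def)
  then have "b \<in> U"
  proof (induction rule: rtrancl_on_induct)
    case base
    show ?case by (rule ab(1))
  next
    case (step y z)
    then show ?case using no UW(1) assms(2) by blast
  qed
  with ab UW show False by blast
qed

section \<open>Transfer to digraphs: 2-connectivity, degrees and copies of spiders\<close>

context graph
begin

lemma sym_rel_dominates: "sym_rel (dominates G)"
proof
  show "a \<rightarrow> b \<Longrightarrow> b \<rightarrow> a" for a b using sym_arcs by (rule arcs_ends_symmetric)
  show "\<not> a \<rightarrow> a" for a using adj_not_same by blast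
qed

lemma two_conn_set_dominates:
  assumes "two_connected G"
  shows "two_conn_set (dominates G) (verts G)"
  unfolding two_conn_set_def
proof
  fix w
  interpret sym_rel "dominates G" by (rule sym_rel_dominates)
  have sub: "parcs (mk_symmetric H) \<subseteq> {(u, v). u \<rightarrow> v}"
    if "arcs H \<subseteq> arcs G" "tail H = tail G" "head H = head G" for H :: "('a, 'b) pre_digraph"
    using that sym by (fastforce simp: parcs_mk_symmetric arcs_ends_conv)
  show "conn_set (dominates G) (verts G - {w})"
  proof (cases "w \<in> verts G")
    case True
    then have "Digraph_Component.connected (del_vert w)"
      using assms by (simp add: two_connected_def)
    then have "conn_set (dominates G) (verts (del_vert w))"
      by (rule conn_set_if_connected) (intro sub, auto simp: del_vert_def)
    then show ?thesis by (simp add: del_vert_def)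
  next
    case False
    have "Digraph_Component.connected G"
      using assms by (simp add: two_connected_def)
    then have "conn_set (dominates G) (verts G)"
      by (rule conn_set_if_connected) (intro sub, auto)
    with False show ?thesis by simp
  qed
qed

text \<open>Without parallel arcs, \<open>head G\<close> is injective on the arcs leaving
  \<open>v\<close>.\<close>

lemma out_degree_eq_deg_in:
  assumes "v \<in> verts G"
  shows "out_degree G v = deg_in (dominates G) (verts G) v"
proof -
  have "head G ` out_arcs G v = {u \<in> verts G. v \<rightarrow> u}"
    by (auto simp: arcs_ends_conv image_iff)
  moreover have "inj_on (head G) (out_arcs G v)"
    using no_multi_arcs by (auto simp: inj_on_def arc_to_ends_def)
  ultimately show ?thesis
    by (simp add: out_degree_def deg_in_def flip: card_image)
qed

text \<open>The lists give an injective vertex map \<open>f\<close>; since an arc is determined by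
  its ends, \<open>f\<close> also determines the map on arcs.\<close>

lemma contains_copy_spiderI:
  assumes root: "r \<in> verts G" and len: "map length Ls = ls"
    and leg: "\<And>i. i < length ls \<Longrightarrow> set (Ls ! i) \<subseteq> verts G \<and> distinct (r # Ls ! i) \<and>
      successively (dominates G) (r # Ls ! i)"
    and disj: "\<And>i j. i < length ls \<Longrightarrow> j < length ls \<Longrightarrow> i \<noteq> j \<Longrightarrow> set (Ls ! i) \<inter> set (Ls ! j) = {}"
  shows "contains_copy G (with_proj (spider ls))"
proof -
  interpret sym_rel "dominates G" by (rule sym_rel_dominates)
  interpret S: pair_graph "spider ls" by (rule pair_graph_spider)
  define f where "f v = (case v of Root \<Rightarrow> r | Leg i j \<Rightarrow> Ls ! i ! j)" for v
  have [simp]: "f Root = r" "f (Leg i j) = Ls ! i ! j" for i j by (simp_all add: f_def)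
  have len': "length Ls = length ls" "\<And>i. i < length ls \<Longrightarrow> length (Ls ! i) = ls ! i"
    using len by auto
  have in_leg: "Ls ! i ! j \<in> set (Ls ! i)" if "i < length ls" "j < ls ! i" for i j
    using that len' by simp
  have adj: "f v \<rightarrow> f (toward_root v)" if mem: "v \<in> leg_verts ls" for v
  proof -
    obtain i j where v: "v = Leg i j" "i < length ls" "j < ls ! i"
      using mem by (auto simp: leg_verts_def)
    \<comment> \<open>With the root prepended, \<open>Leg i j\<close> sits at index
      \<open>Suc j\<close> and its neighbour toward the root at index \<open>j\<close>.\<close>
    have "(r # Ls ! i) ! j \<rightarrow> (r # Ls ! i) ! Suc j"
      by (rule successively_nth) (use leg[OF v(2)] v len' in auto)
    then show ?thesis using v sym by (cases j) auto
  qed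
  have parcs_eq: "parcs (spider ls) =
      (\<Union>v\<in>leg_verts ls. {(v, toward_root v), (toward_root v, v)})"
    by (simp add: spider_def)
  have dom: "f (fst e) \<rightarrow> f (snd e)" if "e \<in> parcs (spider ls)" for e
    using that adj sym unfolding parcs_eq by auto
  have inj: "inj_on f (pverts (spider ls))"
  proof (rule inj_onI)
    fix u v assume uv: "u \<in> pverts (spider ls)" "v \<in> pverts (spider ls)" "f u = f v"
    have root_leg: "r \<noteq> Ls ! i ! j" if "i < length ls" "j < ls ! i" for i j
      using in_leg[OF that] leg[OF that(1)] by auto
    have "i = i' \<and> j = j'"
      if "i < length ls" "j < ls ! i" "i' < length ls" "j' < ls ! i'" "Ls ! i ! j = Ls ! i' ! j'" for i j i' j'
    proof -
      have "i = i'" using disj[OF that(1,3)] in_leg that by (metis disjoint_iff)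
      moreover from this that leg[OF that(1)] len' have "j = j'" by (simp add: nth_eq_iff_index_eq)
      ultimately show ?thesis ..
    qed
    with uv root_leg show "u = v"
      unfolding spider_def leg_verts_def by (auto dest: sym) metis+
  qed
  define g where "g e = the_inv_into (arcs G) (arc_to_ends G) (f (fst e), f (snd e))" for e
  have g: "g e \<in> arcs G" "tail G (g e) = f (fst e)" "head G (g e) = f (snd e)"
    if "e \<in> parcs (spider ls)" for e
  proof -
    have mem: "(f (fst e), f (snd e)) \<in> arc_to_ends G ` arcs G"
      using dom[OF that] by (simp add: arcs_ends_def)
    show "g e \<in> arcs G"
      unfolding g_def using inj_on_arc_to_ends mem by (rule the_inv_into_into) simp
    have "arc_to_ends G (g e) = (f (fst e), f (snd e))"
      unfolding g_def using inj_on_arc_to_ends mem by (rule f_the_inv_into_f)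
    then show "tail G (g e) = f (fst e)" "head G (g e) = f (snd e)"
      by (simp_all add: arc_to_ends_def)
  qed
  \<comment> \<open>The end maps are those of \<open>G\<close>, so that the image is compatible with
    \<open>G\<close>.\<close>
  define h where "h = \<lparr>iso_verts = f, iso_arcs = g, iso_head = head G, iso_tail = tail G\<rparr>"
  have wfS: "wf_digraph (with_proj (spider ls))" by (rule S.wf_digraph)
  have iso: "pre_digraph.digraph_isomorphism (with_proj (spider ls)) h"
  proof -
    have "inj_on g (parcs (spider ls))"
    proof (rule inj_onI)
      fix e e' assume e: "e \<in> parcs (spider ls)" "e' \<in> parcs (spider ls)" "g e = g e'"
      then have "f (fst e) = f (fst e')" "f (snd e) = f (snd e')" using g by metis+
      moreover have "fst e \<in> pverts (spider ls)" "snd e \<in> pverts (spider ls)"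
        "fst e' \<in> pverts (spider ls)" "snd e' \<in> pverts (spider ls)"
        using e S.arc_fst_in_verts S.arc_snd_in_verts by auto
      ultimately show "e = e'" using inj by (auto simp: inj_on_def prod_eq_iff)
    qed
    then show ?thesis
      using wfS inj g unfolding pre_digraph.digraph_isomorphism_def by (simp add: h_def)
  qed
  have "subgraph (app_iso h (with_proj (spider ls))) G"
    unfolding subgraph_def compatible_def
  proof (intro conjI)
    show "verts (app_iso h (with_proj (spider ls))) \<subseteq> verts G"
      using root leg in_leg by (fastforce simp: h_def spider_def leg_verts_def)
    show "arcs (app_iso h (with_proj (spider ls))) \<subseteq> arcs G"
      using g(1) by (auto simp: h_def)
    show "wf_digraph (app_iso h (with_proj (spider ls)))"
      using wfS iso by (rule wf_digraph.wf_digraphI_app_iso)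
  qed (simp_all add: h_def wf_digraph)
  then show ?thesis
    unfolding contains_copy_def digraph_iso_def using iso by blast
qed

end

lemma three_legs_rotate: "three_legs E V r A B C \<Longrightarrow> three_legs E V r C A B"
  by (auto simp: three_legs_def)

theorem theorem5:
  fixes G :: "('a, 'b) pre_digraph" and k l2 l3 l4 :: nat
  assumes "l2 \<ge> 1" and "l3 \<ge> 1" and "l4 \<ge> 1"
    and "k = 1 + l2 + l3 + l4"
    and "graph G"
    and "two_connected G"
    and "average_degree G > real k - 1"
  shows "contains_copy G (with_proj (spider [1, l2, l3, l4]))"
proof -
  interpret graph G by (rule assms(5))
  let ?E = "dominates G" and ?V = "verts G" and ?m = "l2 + l3 + l4"
  interpret R: sym_rel ?E by (rule sym_rel_dominates)
  have two: "two_conn_set ?E ?V" using assms(6) by (rule two_conn_set_dominates)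
  have "0 < card ?V" using assms(6) by (simp add: two_connected_def)
  then have "real (card ?V * ?m) < (\<Sum>v\<in>?V. real (out_degree G v))"
    using assms(4,7) by (simp add: average_degree_def field_simps)
  also have "\<dots> = real (pairs ?E ?V ?V)"
    by (simp add: pairs_def out_degree_eq_deg_in)
  finally have rich: "card ?V * ?m < pairs ?E ?V ?V" by (simp only: of_nat_less_iff)
  obtain r X Y Z where legs: "length X = l2" "length Y = l3" "length Z = l4" "three_legs ?E ?V r X Y Z"
    "?m < deg_in ?E ?V r"
  proof -
    have *: "\<exists>r X Y Z. length X = a \<and> length Y = b \<and> length Z = c \<and> three_legs ?E ?V r X Y Z \<and>
        ?m < deg_in ?E ?V r"
      if "0 < c" "c \<le> a" "c \<le> b" "a + b + c = ?m" for a b c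
      using R.spider_in_two_conn_set[of ?V a b c] two rich that by simp
    \<comment> \<open>The least length takes the part of \<open>c\<close>; the legs are then rotated
      back into the given order.\<close>
    consider "l4 \<le> l2" "l4 \<le> l3" | "l3 \<le> l4" "l3 \<le> l2" | "l2 \<le> l3" "l2 \<le> l4"
      by linarith
    then show thesis
    proof cases
      case 1
      with *[of l4 l2 l3] assms(3) that show thesis by auto
    next
      case 2
      with *[of l3 l4 l2] assms(2) obtain r X Y Z where
        legs: "length X = l2" "length Y = l3" "length Z = l4" "three_legs ?E ?V r Z X Y"
          "?m < deg_in ?E ?V r" by auto
      show thesis
        by (rule that[OF legs(1-3) three_legs_rotate[OF three_legs_rotate[OF legs(4)]] legs(5)])
    next
      case 3
      with *[of l2 l3 l4] assms(1) obtain r X Y Z where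
        legs: "length X = l2" "length Y = l3" "length Z = l4" "three_legs ?E ?V r Y Z X"
          "?m < deg_in ?E ?V r" by auto
      show thesis by (rule that[OF legs(1-3) three_legs_rotate[OF legs(4)] legs(5)])
    qed
  qed
  \<comment> \<open>The legs cover \<open>?m\<close> vertices besides \<open>r\<close>, fewer than
    \<open>r\<close> has neighbours; a neighbour left over is the leg of length 1.\<close>
  have "card (set (X @ Y @ Z)) = ?m"
    using legs(1-4) by (subst distinct_card) (auto simp: three_legs_def)
  then have "\<not> {u \<in> ?V. ?E r u} \<subseteq> set (X @ Y @ Z)"
    using legs(5) card_mono[of "set (X @ Y @ Z)" "{u \<in> ?V. ?E r u}"] by (auto simp: deg_in_def)
  then obtain w where w: "w \<in> ?V" "?E r w" "w \<notin> set (X @ Y @ Z)" by blast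
  show ?thesis
  proof (rule contains_copy_spiderI[where r = r and Ls = "[[w], X, Y, Z]"])
    show "r \<in> ?V" "map length [[w], X, Y, Z] = [1, l2, l3, l4]"
      using legs by (auto simp: three_legs_def)
    have "w \<noteq> r" using w R.irrefl by auto
    then show "set ([[w], X, Y, Z] ! i) \<subseteq> ?V \<and> distinct (r # [[w], X, Y, Z] ! i) \<and>
        successively ?E (r # [[w], X, Y, Z] ! i)"
      if "i < length [1, l2, l3, l4]" for i
      using that w legs(4) by (auto simp: three_legs_def less_Suc_eq)
    show "set ([[w], X, Y, Z] ! i) \<inter> set ([[w], X, Y, Z] ! j) = {}"
      if "i < length [1, l2, l3, l4]" "j < length [1, l2, l3, l4]" "i \<noteq> j" for i j
      using that w legs(4) by (auto simp: three_legs_def less_Suc_eq)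
  qed
qed

end
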